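(* Let $f:[-\pi,\pi]\to\mathbb R$ be even, bounded and continuous a.e., with $\mathcal{ER}(f)=[\inf_{[0,\pi]}f,\sup_{[0,\pi]}f]$. Then, for every $n$ and every a.u. grid $\{x_{i,n}\}_{i=1,\ldots,n}$ in $[0,\pi]$, there exist a real unitary matrix $V_n$ and an ordering of the eigenvalues $\lambda_1(T_n(f)),\ldots,\lambda_n(T_n(f))$ of $T_n(f)$ and $\lambda_1(H_n(f)),\ldots,\lambda_n(H_n(f))$ of $H_n(f)$ such that $$Y_n=V_n\Delta_nV_n^*,\qquad \Delta_n=\operatorname{diag}_{i=1,\ldots,n}(-1)^{i+1},$$ $$T_n(f)=V_nD_nV_n^*,\qquad D_n=\operatorname{diag}_{i=1,\ldots,n}\lambda_i(T_n(f)),$$ $$H_n(f)=V_nE_nV_n^*,\qquad E_n=\Delta_nD_n=\operatorname{diag}_{i=1,\ldots,n}\lambda_i(H_n(f)),$$ $$\lambda_i(H_n(f))=(-1)^{i+1}\lambda_i(T_n(f)),\qquad i=1,\ldots,n,$$ $$\max_{i=1,\ldots,n}|f(x_{i,n})-\lambda_i(T_n(f))|\to0\quad\text{as } n\to\infty.$$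
   Context: For $f\in L^1([-\pi,\pi])$ the Fourier coefficients are $f_k=\frac1{2\pi}\int_{-\pi}^{\pi}f(x)e^{-\mathrm{i}kx}\,dx$, $k\in\mathbb Z$; $T_n(f)=[f_{i-j}]_{i,j=1}^n$ is the $n\times n$ Toeplitz matrix generated by $f$; $Y_n$ is the $n\times n$ exchange matrix, with entries $1$ on the main anti-diagonal ($i+j=n+1$) and $0$ elsewhere; $H_n(f)=Y_nT_n(f)$ is the flipped Toeplitz matrix generated by $f$. Eigenvalues are listed with multiplicity. "Even" means $f(-x)=f(x)$. "A.e." refers to Lebesgue measure $\mu$. The essential range of a measurable $f:\Omega\to\mathbb C$ is $\mathcal{ER}(f)=\{z\in\mathbb C:\ \mu\{|f-z|<\epsilon\}>0\text{ for all }\epsilon>0\}$. A grid is a finite sequence of points in $\mathbb R$. Given, for every $n$, a grid $\mathcal G_n=\{x_{i,n}\}_{i=1,\ldots,d_n}$ of $d_n$ points in $[a,b]$ with $d_n\to\infty$, the grid $\mathcal G_n$ (i.e. the family $(\mathcal G_n)_n$) is called asymptotically uniform (a.u.) in $[a,b]$ if $\lim_{n\to\infty}\max_{i=1,\ldots,d_n}\left|x_{i,n}-\left(a+i\frac{b-a}{d_n+1}\right)\right|=0$. Thus the theorem is about an arbitrary family of grids, one for each $n$, that is a.u. in $[0,\pi]$ with $d_n=n$; the choices of $V_n$ and of the orderings are made for each $n$ and the limit is along the resulting sequence. *)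

theory Defs
  imports "HOL-Analysis.Analysis" "Jordan_Normal_Form.Schur_Decomposition"
begin

text \<open>The integral is taken over the completed measure \<^const>\<open>lebesgue\<close>: a function that is only
  continuous almost everywhere need not be Borel measurable, and the integral with respect to
  \<^const>\<open>lborel\<close> would then be the dummy value 0.\<close>

definition fourier_coeff :: "(real \<Rightarrow> complex) \<Rightarrow> int \<Rightarrow> complex" where
  "fourier_coeff f k =
     1 / (2 * complex_of_real pi) *
       (LINT x:{-pi..pi}|lebesgue. f x * exp (- \<i> * of_int k * complex_of_real x))"

text \<open>Matrix indices start at 0. The entries of a Toeplitz matrix only depend on the difference of
  the indices, and the anti-diagonal \<open>i + j = n + 1\<close> of 1-based indices becomes
  \<open>i + j + 1 = n\<close>.\<close>

definition toeplitz_mat :: "nat \<Rightarrow> (real \<Rightarrow> complex) \<Rightarrow> complex mat" where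
  "toeplitz_mat n f = mat n n (\<lambda>(i, j). fourier_coeff f (int i - int j))"

definition exchange_mat :: "nat \<Rightarrow> complex mat" where
  "exchange_mat n = mat n n (\<lambda>(i, j). if i + j + 1 = n then 1 else 0)"

definition flipped_toeplitz_mat :: "nat \<Rightarrow> (real \<Rightarrow> complex) \<Rightarrow> complex mat" where
  "flipped_toeplitz_mat n f = exchange_mat n * toeplitz_mat n f"

definition real_unitary_mat :: "nat \<Rightarrow> complex mat \<Rightarrow> bool" where
  "real_unitary_mat n V \<longleftrightarrow>
     V \<in> carrier_mat n n \<and> elements_mat V \<subseteq> \<real> \<and>
     V * mat_adjoint V = 1\<^sub>m n \<and> mat_adjoint V * V = 1\<^sub>m n"

text \<open>The diagonal matrix with diagonal entries \<open>d 1, \<dots>, d n\<close>.\<close>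

definition diag1 :: "nat \<Rightarrow> (nat \<Rightarrow> complex) \<Rightarrow> complex mat" where
  "diag1 n d = mat_diag n (\<lambda>i. d (i + 1))"

text \<open>\<open>l 1, \<dots>, l n\<close> is an enumeration of all eigenvalues of the \<open>n \<times> n\<close> matrix \<open>A\<close>, each one
  repeated according to its algebraic multiplicity.\<close>

definition eigenvalue_ordering :: "nat \<Rightarrow> complex mat \<Rightarrow> (nat \<Rightarrow> complex) \<Rightarrow> bool" where
  "eigenvalue_ordering n A l \<longleftrightarrow> char_poly A = (\<Prod>i = 1..n. [:- l i, 1:])"

definition essential_range :: "real set \<Rightarrow> (real \<Rightarrow> complex) \<Rightarrow> complex set" where
  "essential_range \<Omega> f =
     {z. \<forall>\<epsilon>>0. emeasure lebesgue {x \<in> \<Omega>. cmod (f x - z) < \<epsilon>} > 0}"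

text \<open>The points of the \<open>n\<close>-th grid are \<open>x n 1, \<dots>, x n (d n)\<close>. They need be neither distinct nor
  sorted. A maximum over the empty index set (\<open>d n = 0\<close>) is unspecified, but this occurs for only
  finitely many \<open>n\<close>.\<close>

definition asymptotically_uniform ::
    "real \<Rightarrow> real \<Rightarrow> (nat \<Rightarrow> nat) \<Rightarrow> (nat \<Rightarrow> nat \<Rightarrow> real) \<Rightarrow> bool" where
  "asymptotically_uniform a b d x \<longleftrightarrow>
     (\<forall>n. \<forall>i\<in>{1..d n}. x n i \<in> {a..b}) \<and>
     filterlim d at_top sequentially \<and>
     (\<lambda>n. MAX i\<in>{1..d n}. \<bar>x n i - (a + real i * ((b - a) / real (d n + 1)))\<bar>) \<longlonglongrightarrow> 0"

end

(* The Toeplitz matrix of an even symbol is symmetric and commutes with the exchange matrix.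
   Among the orthonormal bases whose vectors are alternately symmetric and skew-symmetric, take one
   maximising sum_i d_i <u_i, T u_i> for distinct weights d_i: a rotation in the plane of two vectors
   of equal parity shows that it is an eigenbasis, and that within a parity class the eigenvalues are
   ordered like the weights, here chosen to be ordered like the samples f(x_i).

   The sine basis has the same parities, and T is close to the matrix that it diagonalises with
   eigenvalues p(k pi / (n + 1)), where p is a cosine polynomial approximating f in L^2. A
   Hoffman-Wielandt argument inside each parity class then shows that the eigenvalues of the class
   are distributed like f, as are the samples f(x_i) by convergence of Riemann sums. Since the
   essential range of f is an interval, which also contains all eigenvalues, two similarly ordered
   families with this distribution are uniformly close. *)

theory Submission
  imports Defs
begin

section \<open>Eigenbases adapted to the exchange matrix\<close>

text \<open>The obstacle is the fixed sign pattern \<open>(-1) ^ (i + 1)\<close>: position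
  \<open>i\<close> of the common eigenbasis must carry a vector of prescribed parity, so the
  eigenvalues cannot be sorted against the samples globally, only within a parity class. Hence
  distribution results and Riemann sums are needed for each class separately. Optimising over real
  bases of prescribed parities builds both the reality of \<open>V\<close> and the sign pattern into
  the constraint, and the optimum comes out already sorted.

  As \<open>f\<close> may be discontinuous, it may have no uniform approximation by polynomials. A
  squared L^2 error of \<delta>^2 enters the Hoffman-Wielandt bound as a squared Frobenius error of
  order \<delta>^2 n, which is harmless after averaging over n. That bound handles Lipschitz test
  functions only, so ramps stand in for counting functions. If the essential range had a gap,
  averages could not locate a single eigenvalue inside it; when it is the whole interval, the
  limiting ramp averages increase strictly with the threshold, and this turns convergence of
  averages into uniform closeness.\<close>

definition dotp :: "nat \<Rightarrow> (nat \<Rightarrow> real) \<Rightarrow> (nat \<Rightarrow> real) \<Rightarrow> real" where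
  "dotp n a b = (\<Sum>j = 1..n. a j * b j)"

definition mult_vec :: "nat \<Rightarrow> (nat \<Rightarrow> nat \<Rightarrow> real) \<Rightarrow> (nat \<Rightarrow> real) \<Rightarrow> nat \<Rightarrow> real" where
  "mult_vec n T a j = dotp n (T j) a"

definition orthonormal :: "nat \<Rightarrow> (nat \<Rightarrow> nat \<Rightarrow> real) \<Rightarrow> bool" where
  "orthonormal n u \<longleftrightarrow> (\<forall>i\<in>{1..n}. \<forall>k\<in>{1..n}. dotp n (u i) (u k) = (if i = k then 1 else 0))"

definition alternating :: "nat \<Rightarrow> (nat \<Rightarrow> nat \<Rightarrow> real) \<Rightarrow> bool" where
  "alternating n u \<longleftrightarrow> (\<forall>i\<in>{1..n}. \<forall>j\<in>{1..n}. u i (n + 1 - j) = (-1) ^ (i + 1) * u i j)"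

definition symmetric :: "nat \<Rightarrow> (nat \<Rightarrow> nat \<Rightarrow> real) \<Rightarrow> bool" where
  "symmetric n T \<longleftrightarrow> (\<forall>i\<in>{1..n}. \<forall>j\<in>{1..n}. T i j = T j i)"

definition centrosymmetric :: "nat \<Rightarrow> (nat \<Rightarrow> nat \<Rightarrow> real) \<Rightarrow> bool" where
  "centrosymmetric n T \<longleftrightarrow>
     (\<forall>i\<in>{1..n}. \<forall>j\<in>{1..n}. T (n + 1 - i) (n + 1 - j) = T i j)"

section \<open>Inner products, orthonormal families and parity\<close>

lemma dotp_commute: "dotp n a b = dotp n b a"
  by (simp add: dotp_def mult.commute)

lemma dotp_lincomb_left:
  "dotp n (\<lambda>j. c * a j + s * b j) w = c * dotp n a w + s * dotp n b w"
  by (simp add: dotp_def sum.distrib sum_distrib_left algebra_simps)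

lemma dotp_lincomb_right:
  "dotp n w (\<lambda>j. c * a j + s * b j) = c * dotp n w a + s * dotp n w b"
  by (simp add: dotp_def sum.distrib sum_distrib_left algebra_simps)

lemma dotp_self: "dotp n a a = (\<Sum>j = 1..n. (a j)\<^sup>2)"
  by (simp add: dotp_def power2_eq_square)

lemma dotp_cong:
  "(\<And>j. j \<in> {1..n} \<Longrightarrow> a j = a' j) \<Longrightarrow> (\<And>j. j \<in> {1..n} \<Longrightarrow> b j = b' j) \<Longrightarrow>
   dotp n a b = dotp n a' b'"
  unfolding dotp_def by (intro sum.cong) auto

lemma mult_vec_lincomb:
  "mult_vec n T (\<lambda>j. c * a j + s * b j) = (\<lambda>j. c * mult_vec n T a j + s * mult_vec n T b j)"
  by (rule ext) (simp add: mult_vec_def dotp_lincomb_right)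

lemma dotp_mult_vec_symmetric:
  assumes "symmetric n T"
  shows "dotp n a (mult_vec n T b) = dotp n b (mult_vec n T a)"
proof -
  have "dotp n a (mult_vec n T b) = (\<Sum>i = 1..n. \<Sum>j = 1..n. a i * T i j * b j)"
    by (simp add: dotp_def mult_vec_def sum_distrib_left mult.assoc)
  also have "\<dots> = (\<Sum>j = 1..n. \<Sum>i = 1..n. a i * T i j * b j)"
    by (rule sum.swap)
  also have "\<dots> = (\<Sum>j = 1..n. \<Sum>i = 1..n. b j * (T j i * a i))"
    using assms by (intro sum.cong refl) (simp add: symmetric_def mult_ac)
  also have "\<dots> = dotp n b (mult_vec n T a)"
    by (simp add: dotp_def mult_vec_def sum_distrib_left)
  finally show ?thesis .
qed

text \<open>Orthonormal rows make \<open>transpose_mat A\<close> a right inverse of the square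
  matrix \<open>A\<close>, and a right inverse of a square matrix is also a left inverse. The
  completeness of \<open>n\<close> orthonormal vectors rests on this.\<close>

lemma orthonormal_columns:
  assumes "orthonormal n u" "j \<in> {1..n}" "l \<in> {1..n}"
  shows "(\<Sum>i = 1..n. u i j * u i l) = (if j = l then 1 else 0)"
proof -
  define A where "A = mat n n (\<lambda>(i, j). u (i + 1) (j + 1))"
  have car: "A \<in> carrier_mat n n" by (simp add: A_def)
  have shift: "(\<Sum>k\<in>{0..<n}. g (k + 1)) = (\<Sum>k = 1..n. g k)" for g :: "nat \<Rightarrow> real"
    using sum.shift_bounds_nat_ivl[of g 0 1 n] by (simp add: atLeastLessThanSuc_atLeastAtMost)
  have "A * transpose_mat A = 1\<^sub>m n"
  proof (rule eq_matI)
    fix i k assume ik: "i < dim_row (1\<^sub>m n :: real mat)" "k < dim_col (1\<^sub>m n :: real mat)"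
    then have "(A * transpose_mat A) $$ (i, k) = dotp n (u (i + 1)) (u (k + 1))"
      using shift[of "\<lambda>m. u (i + 1) m * u (k + 1) m"]
      by (simp add: A_def scalar_prod_def dotp_def)
    then show "(A * transpose_mat A) $$ (i, k) = 1\<^sub>m n $$ (i, k)"
      using assms(1) ik by (simp add: orthonormal_def)
  qed (use car in auto)
  then have "transpose_mat A * A = 1\<^sub>m n"
    using mat_mult_left_right_inverse[OF car] car by simp
  then have "(transpose_mat A * A) $$ (j - 1, l - 1) = 1\<^sub>m n $$ (j - 1, l - 1)" by simp
  moreover have "(transpose_mat A * A) $$ (j - 1, l - 1) = (\<Sum>i = 1..n. u i j * u i l)"
  proof -
    have "j - 1 < n" "l - 1 < n" "Suc (j - Suc 0) = j" "Suc (l - Suc 0) = l"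
      using assms(2,3) by auto
    then show ?thesis
      using shift[of "\<lambda>m. u m j * u m l"] by (simp add: A_def scalar_prod_def)
  qed
  ultimately show ?thesis using assms(2,3) by (auto simp: eq_diff_iff)
qed

lemma orthonormal_expansion:
  assumes "orthonormal n u" "j \<in> {1..n}"
  shows "(\<Sum>i = 1..n. dotp n (u i) w * u i j) = w j"
proof -
  have "(\<Sum>i = 1..n. dotp n (u i) w * u i j) = (\<Sum>i = 1..n. \<Sum>l = 1..n. w l * (u i l * u i j))"
    unfolding dotp_def sum_distrib_right by (intro sum.cong refl) (simp add: mult_ac)
  also have "\<dots> = (\<Sum>l = 1..n. w l * (\<Sum>i = 1..n. u i l * u i j))"
    by (subst sum.swap) (simp add: sum_distrib_left)
  also have "\<dots> = (\<Sum>l = 1..n. if l = j then w l else 0)"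
    using assms by (intro sum.cong refl) (simp add: orthonormal_columns del: One_nat_def)
  also have "\<dots> = w j" using assms(2) by simp
  finally show ?thesis .
qed

lemma orthonormal_Parseval:
  assumes "orthonormal n u"
  shows "(\<Sum>i = 1..n. (dotp n (u i) w)\<^sup>2) = dotp n w w"
proof -
  have "dotp n w w = (\<Sum>j = 1..n. w j * (\<Sum>i = 1..n. dotp n (u i) w * u i j))"
    unfolding dotp_def[of n w w]
    using assms by (intro sum.cong refl) (simp only: orthonormal_expansion)
  also have "\<dots> = (\<Sum>i = 1..n. \<Sum>j = 1..n. dotp n (u i) w * (u i j * w j))"
    by (subst sum.swap) (simp add: sum_distrib_left mult_ac)
  also have "\<dots> = (\<Sum>i = 1..n. (dotp n (u i) w)\<^sup>2)"
    by (simp add: sum_distrib_left[symmetric] power2_eq_square dotp_def)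
  finally show ?thesis by simp
qed

text \<open>Reversing the index multiplies every summand by the product of the two parities, here
  -1, so the sum equals its own negative. Two families are allowed because \<open>v\<close> will
  also be the image of \<open>u\<close> under \<open>T\<close>.\<close>

lemma alternating_dotp_zero:
  assumes "alternating n u" "alternating n v" "p \<in> {1..n}" "q \<in> {1..n}" "even p \<noteq> even q"
  shows "dotp n (u p) (v q) = 0"
proof -
  have "dotp n (u p) (v q) = (\<Sum>j = 1..n. u p (n + 1 - j) * v q (n + 1 - j))"
    unfolding dotp_def by (rule sum.atLeastAtMost_rev)
  also have "\<dots> = (\<Sum>j = 1..n. - (u p j * v q j))"
    using assms by (intro sum.cong refl) (cases "even p"; simp add: alternating_def)
  also have "\<dots> = - dotp n (u p) (v q)" by (simp add: dotp_def sum_negf)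
  finally show ?thesis by simp
qed

text \<open>A centrosymmetric matrix commutes with the flip of the coordinates and so preserves both
  parity spaces.\<close>

lemma alternating_mult_vec:
  assumes "alternating n u" "centrosymmetric n T"
  shows "alternating n (\<lambda>i. mult_vec n T (u i))"
  unfolding alternating_def
proof (intro ballI)
  fix i j assume ij: "i \<in> {1..n}" "j \<in> {1..n}"
  have "mult_vec n T (u i) (n + 1 - j) = (\<Sum>l = 1..n. T (n + 1 - j) (n + 1 - l) * u i (n + 1 - l))"
    unfolding mult_vec_def dotp_def by (rule sum.atLeastAtMost_rev)
  also have "\<dots> = (\<Sum>l = 1..n. (-1) ^ (i + 1) * (T j l * u i l))"
  proof (intro sum.cong refl)
    fix l assume l: "l \<in> {1..n}"
    have "T (n + 1 - j) (n + 1 - l) = T j l" "u i (n + 1 - l) = (-1) ^ (i + 1) * u i l"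
      using assms ij l unfolding alternating_def centrosymmetric_def by blast+
    then show "T (n + 1 - j) (n + 1 - l) * u i (n + 1 - l) = (-1) ^ (i + 1) * (T j l * u i l)"
      by simp
  qed
  also have "\<dots> = (-1) ^ (i + 1) * mult_vec n T (u i) j"
    by (simp only: sum_distrib_left mult_vec_def dotp_def)
  finally show "mult_vec n T (u i) (n + 1 - j) = (-1) ^ (i + 1) * mult_vec n T (u i) j" .
qed

text \<open>Fixing the values outside \<open>{1..n}\<close> leaves finitely many free entries;
  otherwise the set would not be compact in the product topology.\<close>

definition alternating_bases :: "nat \<Rightarrow> (nat \<Rightarrow> nat \<Rightarrow> real) set" where
  "alternating_bases n = {u. orthonormal n u \<and> alternating n u \<and>
     (\<forall>i j. i \<notin> {1..n} \<or> j \<notin> {1..n} \<longrightarrow> u i j = 0)}"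

section \<open>Compactness of the set of alternating orthonormal bases\<close>

lemma compact_Pi_UNIV:
  fixes S :: "'i \<Rightarrow> 'a::topological_space set"
  assumes "\<And>i. compact (S i)"
  shows "compact {f. \<forall>i. f i \<in> S i}"
proof -
  have "compactin (product_topology (\<lambda>i::'i. euclidean :: 'a topology) UNIV) (PiE UNIV S)"
    using assms by (subst compactin_PiE) auto
  moreover have "PiE UNIV S = {f. \<forall>i. f i \<in> S i}" by (auto simp: PiE_def)
  ultimately show ?thesis by (simp add: euclidean_product_topology)
qed

lemma continuous_on_entry: "continuous_on S (\<lambda>u::nat \<Rightarrow> nat \<Rightarrow> real. u i j)"
  by (rule continuous_on_product_then_coordinatewise,
      rule continuous_on_product_then_coordinatewise, rule continuous_on_id)

lemma closed_orthonormal: "closed {u. orthonormal n u}"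
proof -
  have eq: "{u. orthonormal n u} =
     (\<Inter>i\<in>{1..n}. \<Inter>k\<in>{1..n}. {u. (\<Sum>j = 1..n. u i j * u k j) = (if i = k then 1 else 0)})"
    by (auto simp: orthonormal_def dotp_def)
  show ?thesis unfolding eq
    by (intro closed_INT ballI closed_Collect_eq continuous_on_sum continuous_on_mult
        continuous_on_entry continuous_on_const)
qed

lemma closed_alternating: "closed {u. alternating n u}"
proof -
  have eq: "{u. alternating n u} =
     (\<Inter>i\<in>{1..n}. \<Inter>j\<in>{1..n}. {u. u i (n + 1 - j) = (-1) ^ (i + 1) * u i j})"
    by (auto simp: alternating_def)
  show ?thesis unfolding eq
    by (intro closed_INT ballI closed_Collect_eq continuous_on_mult
        continuous_on_entry continuous_on_const)
qed

text \<open>The defining equations are closed conditions, and unit vectors have entries in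
  \<open>{-1..1}\<close>, so the set is a closed part of the cube \<open>B\<close>, which is compact
  by Tychonoff's theorem.\<close>

lemma compact_alternating_bases: "compact (alternating_bases n)"
proof -
  define B where "B = {u :: nat \<Rightarrow> nat \<Rightarrow> real. \<forall>i. u i \<in> {a. \<forall>j. a j \<in> {-1..1}}}"
  have "compact B" unfolding B_def by (intro compact_Pi_UNIV) auto
  define Z where "Z = {u :: nat \<Rightarrow> nat \<Rightarrow> real. \<forall>i j. i \<notin> {1..n} \<or> j \<notin> {1..n} \<longrightarrow> u i j = 0}"
  have Z_eq: "Z = (\<Inter>p\<in>{p. fst p \<notin> {1..n} \<or> snd p \<notin> {1..n}}. {u. u (fst p) (snd p) = 0})"
    by (auto simp: Z_def)
  have "closed Z" unfolding Z_eq
    by (intro closed_INT ballI closed_Collect_eq continuous_on_entry continuous_on_const)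
  have eq: "alternating_bases n = {u. orthonormal n u} \<inter> {u. alternating n u} \<inter> Z"
    by (auto simp: alternating_bases_def Z_def)
  have "alternating_bases n \<subseteq> B"
  proof
    fix u assume u: "u \<in> alternating_bases n"
    have "\<bar>u i j\<bar> \<le> 1" for i j
    proof (cases "i \<in> {1..n} \<and> j \<in> {1..n}")
      case True
      have "(u i j)\<^sup>2 \<le> (\<Sum>j = 1..n. (u i j)\<^sup>2)"
        by (rule member_le_sum) (use True in auto)
      also have "\<dots> = 1"
        using u True by (auto simp: alternating_bases_def orthonormal_def dotp_self[symmetric] simp del: One_nat_def)
      finally show ?thesis by (simp add: abs_square_le_1)
    next
      case False
      then have "u i j = 0" using u unfolding alternating_bases_def by blast
      then show ?thesis by simp
    qed
    then have "- 1 \<le> u i j \<and> u i j \<le> 1" for i j by (simp add: abs_le_iff minus_le_iff)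
    then show "u \<in> B" by (simp add: B_def)
  qed
  moreover have "closed (alternating_bases n)"
    unfolding eq by (intro closed_Int closed_orthonormal closed_alternating \<open>closed Z\<close>)
  ultimately show ?thesis
    using \<open>compact B\<close> by (metis compact_Int_closed inf.absorb2)
qed

text \<open>Vectors of one parity form a linear space, so rotating within it keeps the parity;
  mixing opposite parities would in general destroy it.\<close>

lemma rotation_in_alternating_bases:
  assumes u: "u \<in> alternating_bases n" and pq: "p \<in> {1..n}" "q \<in> {1..n}" "p \<noteq> q"
    "even p = even q" and cs: "c\<^sup>2 + s\<^sup>2 = 1"
  shows "u(p := \<lambda>j. c * u p j + s * u q j, q := \<lambda>j. (-s) * u p j + c * u q j)
     \<in> alternating_bases n"
proof -
  define a where "a = (\<lambda>j. c * u p j + s * u q j)"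
  define b where "b = (\<lambda>j. (-s) * u p j + c * u q j)"
  let ?u = "u(p := a, q := b)"
  have o: "dotp n (u i) (u k) = (if i = k then 1 else 0)" if "i \<in> {1..n}" "k \<in> {1..n}" for i k
    using u that by (simp add: alternating_bases_def orthonormal_def)
  have cs': "c * c + s * s = 1" using cs by (simp add: power2_eq_square)
  have 1: "dotp n a (u i) = (if i = p then c else if i = q then s else 0)"
       "dotp n b (u i) = (if i = p then -s else if i = q then c else 0)" if "i \<in> {1..n}" for i
    unfolding a_def b_def dotp_lincomb_left using o[OF pq(1) that] o[OF pq(2) that] pq by auto
  have 2: "dotp n a a = 1" "dotp n b b = 1" "dotp n a b = 0"
    unfolding a_def b_def dotp_lincomb_left dotp_lincomb_right using o pq cs'
    by (simp_all add: algebra_simps)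
  have "orthonormal n ?u"
    unfolding orthonormal_def
  proof (intro ballI)
    fix i k assume ik: "i \<in> {1..n}" "k \<in> {1..n}"
    show "dotp n (?u i) (?u k) = (if i = k then 1 else 0)"
      using pq(3) 1[OF ik(1)] 1[OF ik(2)] 2 o[OF ik] dotp_commute[of n "u i" a]
        dotp_commute[of n "u i" b] dotp_commute[of n b a] by auto
  qed
  moreover have "alternating n ?u"
    unfolding alternating_def
  proof (intro ballI)
    fix i j assume ij: "i \<in> {1..n}" "j \<in> {1..n}"
    have alt: "u i (n + 1 - j) = (-1) ^ (i + 1) * u i j" if "i \<in> {1..n}" for i
      using u that ij by (auto simp: alternating_bases_def alternating_def)
    have qp: "(-1) ^ (q + 1) = ((-1) ^ (p + 1) :: real)"
      using pq(4) by (cases "even p") auto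
    have "a (n + 1 - j) = (-1) ^ (p + 1) * a j" "b (n + 1 - j) = (-1) ^ (q + 1) * b j"
      unfolding a_def b_def alt[OF pq(1)] alt[OF pq(2)] qp by (simp_all only: distrib_left mult_ac)
    then show "?u i (n + 1 - j) = (-1) ^ (i + 1) * ?u i j"
      using alt[OF ij(1)] by (auto simp only: fun_upd_apply split: if_split)
  qed
  moreover have "\<forall>i j. i \<notin> {1..n} \<or> j \<notin> {1..n} \<longrightarrow> ?u i j = 0"
    using u pq by (auto simp: alternating_bases_def a_def b_def)
  ultimately have "?u \<in> alternating_bases n" by (simp add: alternating_bases_def)
  then show ?thesis by (simp only: a_def b_def)
qed

text \<open>For a small angle the left side is linear and the right side quadratic in
  \<open>s\<close>, so a nonzero \<open>X\<close> violates the inequality for one of the two signs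
  of the angle. The rational parametrisation of the circle avoids derivatives.\<close>

lemma small_perturbation_zero:
  fixes X Y :: real
  assumes "\<And>c s. c\<^sup>2 + s\<^sup>2 = 1 \<Longrightarrow> 2 * c * s * X \<le> s\<^sup>2 * Y"
  shows "X = 0"
proof -
  have 1: "(1 - t\<^sup>2) * t * X \<le> t\<^sup>2 * Y" for t
  proof -
    have pos: "1 + t\<^sup>2 > 0" by (simp add: add_pos_nonneg)
    have id: "(1 - t\<^sup>2)\<^sup>2 + (2 * t)\<^sup>2 = (1 + t\<^sup>2)\<^sup>2" by (simp add: power2_eq_square algebra_simps)
    have "((1 - t\<^sup>2) / (1 + t\<^sup>2))\<^sup>2 + (2 * t / (1 + t\<^sup>2))\<^sup>2 = 1"
      unfolding power_divide add_divide_distrib[symmetric] id using pos by simp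
    from assms[OF this] have
      "4 * ((1 - t\<^sup>2) * t * X) / (1 + t\<^sup>2)\<^sup>2 \<le> 4 * (t\<^sup>2 * Y) / (1 + t\<^sup>2)\<^sup>2"
      by (simp add: power2_eq_square mult_ac)
    then show ?thesis using pos by (simp add: divide_le_cancel zero_less_power)
  qed
  have False if "X \<noteq> 0"
  proof -
    \<comment> \<open>This choice gives both
      \<open>r * \<bar>Y\<bar> \<le> \<bar>X\<bar> / 2\<close> and \<open>r \<le> 1 / 2\<close>; the
      latter makes \<open>1 - r\<^sup>2\<close> at least 3/4.\<close>
    define r where "r = \<bar>X\<bar> / (2 * (\<bar>X\<bar> + \<bar>Y\<bar>))"
    have r: "0 < r" "r \<le> 1 / 2" using that by (auto simp: r_def field_simps)
    have "r * \<bar>Y\<bar> \<le> \<bar>X\<bar> / 2" using that by (simp add: r_def field_simps)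
    have "r\<^sup>2 \<le> (1/2)\<^sup>2" using r by (intro power_mono) auto
    then have r2: "3 / 4 \<le> 1 - r\<^sup>2" by (simp add: power2_eq_square)
    \<comment> \<open>The parameters \<open>r\<close> and \<open>-r\<close> cover both signs of
      \<open>X\<close>.\<close>
    have "(1 - r\<^sup>2) * r * \<bar>X\<bar> \<le> r\<^sup>2 * Y"
      using 1[of r] 1[of "-r"] by (auto simp: abs_if)
    then have "r * ((1 - r\<^sup>2) * \<bar>X\<bar>) \<le> r * (r * Y)" by (simp add: power2_eq_square mult_ac)
    then have "(1 - r\<^sup>2) * \<bar>X\<bar> \<le> r * Y" using r by simp
    also have "\<dots> \<le> r * \<bar>Y\<bar>" using r by (intro mult_left_mono) auto
    also have "\<dots> \<le> \<bar>X\<bar> / 2" by fact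
    finally have "(1 - r\<^sup>2) * \<bar>X\<bar> \<le> \<bar>X\<bar> / 2" .
    moreover have "3 / 4 * \<bar>X\<bar> \<le> (1 - r\<^sup>2) * \<bar>X\<bar>" using r2 by (intro mult_right_mono) auto
    ultimately show False using that by simp
  qed
  then show ?thesis by blast
qed

text \<open>At a maximiser of the weighted trace, stationarity under small rotations gives
  \<open>B (u p) (u q) = 0\<close> within a parity class, because the weights differ; between the
  classes it holds by parity. A quarter turn exchanges two vectors up to sign and forces the order
  of the eigenvalues. The family \<open>v\<close> shows that there are competitors at all.\<close>

lemma alternating_eigenbasis:
  assumes sym: "symmetric n T" and cent: "centrosymmetric n T"
    and v: "orthonormal n v" "alternating n v" and d: "inj_on d {1..n}"
  obtains u :: "nat \<Rightarrow> nat \<Rightarrow> real" and l :: "nat \<Rightarrow> real" where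
    "orthonormal n u" "alternating n u"
    "\<And>i j. i \<in> {1..n} \<Longrightarrow> j \<in> {1..n} \<Longrightarrow> mult_vec n T (u i) j = l i * u i j"
    "\<And>p q. p \<in> {1..n} \<Longrightarrow> q \<in> {1..n} \<Longrightarrow> even p = even q \<Longrightarrow> d p < (d q :: real) \<Longrightarrow> l p \<le> l q"
proof -
  define B where "B a b = dotp n a (mult_vec n T b)" for a b
  define F where "F u = (\<Sum>i = 1..n. d i * B (u i) (u i))" for u
  \<comment> \<open>Cutting \<open>v\<close> off outside the index range puts it into
    \<open>alternating_bases n\<close>.\<close>
  let ?v = "\<lambda>i j. if i \<in> {1..n} \<and> j \<in> {1..n} then v i j else 0"
  have "dotp n (?v i) (?v k) = dotp n (v i) (v k)" if "i \<in> {1..n}" "k \<in> {1..n}" for i k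
    using that by (intro dotp_cong) auto
  then have "?v \<in> alternating_bases n"
    using v by (auto simp: alternating_bases_def orthonormal_def alternating_def)
  moreover have "continuous_on (alternating_bases n) F"
    unfolding F_def B_def dotp_def mult_vec_def
    by (intro continuous_on_sum continuous_on_mult continuous_on_entry continuous_on_const)
  ultimately obtain u where u: "u \<in> alternating_bases n"
    and max: "\<And>w. w \<in> alternating_bases n \<Longrightarrow> F w \<le> F u"
    using continuous_attains_sup[OF compact_alternating_bases, of n F] by blast
  have on: "orthonormal n u" and alt: "alternating n u"
    using u by (auto simp: alternating_bases_def)
  have comm: "B a b = B b a" for a b
    unfolding B_def by (rule dotp_mult_vec_symmetric[OF sym])
  \<comment> \<open>A rotation keeps the sum of the two diagonal values, so the change of
    \<open>F\<close> is \<open>d p - d q\<close> times the change of \<open>B (u p) (u p)\<close>;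
    maximality makes it nonpositive.\<close>
  have key: "(d p - d q) * (2 * c * s * B (u p) (u q)) \<le>
      (d p - d q) * (s\<^sup>2 * (B (u p) (u p) - B (u q) (u q)))"
    if pq: "p \<in> {1..n}" "q \<in> {1..n}" "p \<noteq> q" "even p = even q" and cs: "c\<^sup>2 + s\<^sup>2 = 1" for p q c s
  proof -
    define a where "a = (\<lambda>j. c * u p j + s * u q j)"
    define b where "b = (\<lambda>j. (-s) * u p j + c * u q j)"
    let ?u = "u(p := a, q := b)"
    have le: "F ?u \<le> F u"
      using max[OF rotation_in_alternating_bases[OF u pq cs]] by (simp only: a_def b_def)
    have split: "F w = (\<Sum>i\<in>{1..n} - {p, q}. d i * B (w i) (w i)) + d p * B (w p) (w p) + d q * B (w q) (w q)" for w
    proof -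
      have "F w = (\<Sum>i\<in>{1..n} - {p, q}. d i * B (w i) (w i)) + (\<Sum>i\<in>{p, q}. d i * B (w i) (w i))"
        unfolding F_def using pq by (intro sum.subset_diff) auto
      then show ?thesis using pq(3) by simp
    qed
    have "(\<Sum>i\<in>{1..n} - {p, q}. d i * B (?u i) (?u i)) = (\<Sum>i\<in>{1..n} - {p, q}. d i * B (u i) (u i))"
      by (intro sum.cong refl) auto
    then have "d p * B a a + d q * B b b \<le> d p * B (u p) (u p) + d q * B (u q) (u q)"
      using le pq(3) unfolding split by simp
    moreover have c2: "c * c = 1 - s * s" using cs by (simp add: power2_eq_square)
    have "B a a = c * c * B (u p) (u p) + 2 * c * s * B (u p) (u q) + s * s * B (u q) (u q)"
      unfolding B_def a_def mult_vec_lincomb dotp_lincomb_left dotp_lincomb_right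
      using comm[of "u q" "u p"] by (simp add: B_def algebra_simps)
    then have "B a a = B (u p) (u p) + (2 * c * s * B (u p) (u q) - s * s * (B (u p) (u p) - B (u q) (u q)))"
      unfolding c2 by (simp add: algebra_simps)
    moreover have "B b b = s * s * B (u p) (u p) - 2 * c * s * B (u p) (u q) + c * c * B (u q) (u q)"
      unfolding B_def b_def mult_vec_lincomb dotp_lincomb_left dotp_lincomb_right
      using comm[of "u q" "u p"] by (simp add: B_def algebra_simps)
    then have "B b b = B (u q) (u q) - (2 * c * s * B (u p) (u q) - s * s * (B (u p) (u p) - B (u q) (u q)))"
      unfolding c2 by (simp add: algebra_simps)
    ultimately show ?thesis by (simp add: algebra_simps power2_eq_square)
  qed
  have off: "B (u p) (u q) = 0" if pq: "p \<in> {1..n}" "q \<in> {1..n}" "p \<noteq> q" for p q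
  proof (cases "even p = even q")
    case True
    have "(d p - d q) * B (u p) (u q) = 0"
    proof (rule small_perturbation_zero)
      fix c s :: real assume "c\<^sup>2 + s\<^sup>2 = 1"
      from key[OF pq True this]
      show "2 * c * s * ((d p - d q) * B (u p) (u q)) \<le> s\<^sup>2 * ((d p - d q) * (B (u p) (u p) - B (u q) (u q)))"
        by (simp only: mult_ac)
    qed
    moreover have "d p \<noteq> d q" using d pq by (auto dest: inj_onD)
    ultimately show ?thesis by simp
  next
    case False
    then show ?thesis unfolding B_def
      using alternating_dotp_zero[OF alt alternating_mult_vec[OF alt cent]] pq by blast
  qed
  define l where "l i = B (u i) (u i)" for i
  show thesis
  proof
    show "orthonormal n u" "alternating n u" by (fact on alt)+
    fix i j assume ij: "i \<in> {1..n}" "j \<in> {1..n}"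
    have "mult_vec n T (u i) j = (\<Sum>k = 1..n. dotp n (u k) (mult_vec n T (u i)) * u k j)"
      using on ij by (simp only: orthonormal_expansion)
    also have "\<dots> = (\<Sum>k = 1..n. if k = i then l i * u i j else 0)"
      using off ij by (intro sum.cong refl) (auto simp: B_def l_def)
    also have "\<dots> = l i * u i j" using ij by simp
    finally show "mult_vec n T (u i) j = l i * u i j" .
  next
    fix p q assume pq: "p \<in> {1..n}" "q \<in> {1..n}" "even p = even q" "d p < d q"
    \<comment> \<open>The quarter turn \<open>c = 0\<close>, \<open>s = 1\<close>, for which the
      mixed term vanishes.\<close>
    then have "0 \<le> (d p - d q) * (l p - l q)"
      using key[of p q 0 1] by (auto simp: l_def)
    then show "l p \<le> l q" using pq(4) by (simp add: zero_le_mult_iff)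
  qed
qed

section \<open>Comparison of eigenvalues and the sine basis\<close>

text \<open>As the sign of \<open>u i\<close> is \<open>(-1) ^ (i + 1)\<close>, the class
  \<open>e = True\<close> of even indices carries the skew-symmetric vectors.\<close>

definition parity_class :: "nat \<Rightarrow> bool \<Rightarrow> nat set" where
  "parity_class n e = {i \<in> {1..n}. even i = e}"

lemma finite_parity_class [simp]: "finite (parity_class n e)"
  by (simp add: parity_class_def)

lemma sum_parity_class_le:
  "(\<And>i. i \<in> {1..n} \<Longrightarrow> 0 \<le> g i) \<Longrightarrow> (\<Sum>i\<in>parity_class n e. g i) \<le> (\<Sum>i = 1..n. g i :: real)"
  by (rule sum_mono2) (auto simp: parity_class_def)

text \<open>Parseval loses nothing when restricted to the class, since vectors of the other parity
  are orthogonal to \<open>v k\<close>. Each class thus has its own doubly stochastic matrix and can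
  be treated alone.\<close>

lemma sum_parity_class_dotp_squares:
  assumes "orthonormal n u" "alternating n u" "orthonormal n v" "alternating n v"
    and k: "k \<in> parity_class n e"
  shows "(\<Sum>i\<in>parity_class n e. (dotp n (u i) (v k))\<^sup>2) = 1"
proof -
  have k1: "k \<in> {1..n}" "even k = e" using k by (auto simp: parity_class_def)
  have "(\<Sum>i\<in>parity_class n e. (dotp n (u i) (v k))\<^sup>2) = (\<Sum>i = 1..n. (dotp n (u i) (v k))\<^sup>2)"
  proof (rule sum.mono_neutral_left)
    show "\<forall>i\<in>{1..n} - parity_class n e. (dotp n (u i) (v k))\<^sup>2 = 0"
    proof
      fix i assume "i \<in> {1..n} - parity_class n e"
      then have "i \<in> {1..n}" "even i \<noteq> even k" using k1 by (auto simp: parity_class_def)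
      then show "(dotp n (u i) (v k))\<^sup>2 = 0"
        using alternating_dotp_zero[OF assms(2,4)] k1 by simp
    qed
  qed (auto simp: parity_class_def)
  also have "\<dots> = dotp n (v k) (v k)" by (rule orthonormal_Parseval) fact
  also have "\<dots> = 1" using assms(3) k1 unfolding orthonormal_def by auto
  finally show ?thesis .
qed

text \<open>A substitute for the Cauchy-Schwarz inequality: averages of absolute values are traded
  for averages of squares, with \<delta> still free.\<close>

lemma abs_le_add_square_div:
  fixes x :: real
  assumes "\<delta> > 0"
  shows "\<bar>x\<bar> \<le> \<delta> + x\<^sup>2 / \<delta>"
proof (cases "\<bar>x\<bar> \<le> \<delta>")
  case False
  then have "\<bar>x\<bar> * \<delta> \<le> \<bar>x\<bar> * \<bar>x\<bar>" by (intro mult_left_mono) auto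
  then have "\<bar>x\<bar> \<le> x\<^sup>2 / \<delta>" using assms by (simp add: field_simps power2_eq_square)
  then show ?thesis using assms by linarith
qed (use assms in \<open>simp add: add_increasing2\<close>)

text \<open>A variant of the Hoffman--Wielandt inequality: the squares of the inner products
  \<open>u i \<cdot> v k\<close> form a doubly stochastic matrix.\<close>

lemma eigenvalue_sum_comparison:
  assumes sym: "symmetric n T"
    and u: "orthonormal n u" "alternating n u"
    and v: "orthonormal n v" "alternating n v"
    and eig: "\<And>i j. i \<in> {1..n} \<Longrightarrow> j \<in> {1..n} \<Longrightarrow> mult_vec n T (u i) j = l i * u i j"
    and lip: "\<And>a b. \<bar>\<phi> a - \<phi> b\<bar> \<le> L * \<bar>a - b\<bar>" and L: "L \<ge> 0" and \<delta>: "\<delta> > 0"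
  shows "\<bar>(\<Sum>i\<in>parity_class n e. \<phi> (l i)) - (\<Sum>k\<in>parity_class n e. \<phi> (m k))\<bar> \<le>
    L * (\<delta> * n + (\<Sum>k = 1..n. \<Sum>j = 1..n. (mult_vec n T (v k) j - m k * v k j)\<^sup>2) / \<delta>)"
proof -
  let ?I = "parity_class n e"
  define W where "W i k = (dotp n (u i) (v k))\<^sup>2" for i k
  have W0: "W i k \<ge> 0" for i k by (simp add: W_def)
  have W1: "(\<Sum>i\<in>?I. W i k) = 1" if "k \<in> ?I" for k
    unfolding W_def by (rule sum_parity_class_dotp_squares[OF u v that])
  have W2: "(\<Sum>k\<in>?I. W i k) = 1" if "i \<in> ?I" for i
    unfolding W_def using sum_parity_class_dotp_squares[OF v u that]
    by (simp add: dotp_commute)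
  have "(\<Sum>i\<in>?I. \<phi> (l i)) = (\<Sum>i\<in>?I. \<Sum>k\<in>?I. W i k * \<phi> (l i))"
    by (intro sum.cong refl) (simp add: sum_distrib_right[symmetric] W2)
  moreover have "(\<Sum>k\<in>?I. \<phi> (m k)) = (\<Sum>i\<in>?I. \<Sum>k\<in>?I. W i k * \<phi> (m k))"
    by (subst sum.swap, intro sum.cong refl) (simp add: sum_distrib_right[symmetric] W1)
  ultimately have "\<bar>(\<Sum>i\<in>?I. \<phi> (l i)) - (\<Sum>k\<in>?I. \<phi> (m k))\<bar>
      = \<bar>\<Sum>i\<in>?I. \<Sum>k\<in>?I. W i k * (\<phi> (l i) - \<phi> (m k))\<bar>"
    by (simp add: sum_subtractf right_diff_distrib)
  also have "\<dots> \<le> (\<Sum>i\<in>?I. \<bar>\<Sum>k\<in>?I. W i k * (\<phi> (l i) - \<phi> (m k))\<bar>)"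
    by (rule sum_abs)
  also have "\<dots> \<le> (\<Sum>i\<in>?I. \<Sum>k\<in>?I. \<bar>W i k * (\<phi> (l i) - \<phi> (m k))\<bar>)"
    by (intro sum_mono sum_abs)
  also have "\<dots> \<le> (\<Sum>i\<in>?I. \<Sum>k\<in>?I. L * (\<delta> * W i k + W i k * (l i - m k)\<^sup>2 / \<delta>))"
  proof (intro sum_mono)
    fix i k
    have "\<bar>\<phi> (l i) - \<phi> (m k)\<bar> \<le> L * (\<delta> + (l i - m k)\<^sup>2 / \<delta>)"
      using lip[of "l i" "m k"] mult_left_mono[OF abs_le_add_square_div[OF \<delta>] L] by (rule order_trans)
    then have "W i k * \<bar>\<phi> (l i) - \<phi> (m k)\<bar> \<le> W i k * (L * (\<delta> + (l i - m k)\<^sup>2 / \<delta>))"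
      using W0 by (rule mult_left_mono)
    moreover have "\<bar>W i k * (\<phi> (l i) - \<phi> (m k))\<bar> = W i k * \<bar>\<phi> (l i) - \<phi> (m k)\<bar>"
      by (simp only: abs_mult abs_of_nonneg[OF W0])
    ultimately show "\<bar>W i k * (\<phi> (l i) - \<phi> (m k))\<bar> \<le> L * (\<delta> * W i k + W i k * (l i - m k)\<^sup>2 / \<delta>)"
      by (simp add: algebra_simps)
  qed
  also have "\<dots> = L * (\<delta> * (\<Sum>i\<in>?I. \<Sum>k\<in>?I. W i k) + (\<Sum>i\<in>?I. \<Sum>k\<in>?I. W i k * (l i - m k)\<^sup>2) / \<delta>)"
    by (simp add: sum_distrib_left sum.distrib sum_divide_distrib distrib_left)
  also have "\<dots> \<le> L * (\<delta> * n + (\<Sum>k = 1..n. \<Sum>j = 1..n. (mult_vec n T (v k) j - m k * v k j)\<^sup>2) / \<delta>)"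
  proof -
    have "(\<Sum>i\<in>?I. \<Sum>k\<in>?I. W i k) = (\<Sum>i\<in>?I. 1)" by (intro sum.cong refl W2)
    also have "\<dots> \<le> (\<Sum>i = 1..n. 1)" by (rule sum_parity_class_le) simp
    finally have a: "(\<Sum>i\<in>?I. \<Sum>k\<in>?I. W i k) \<le> n" by simp
    \<comment> \<open>Both sums are enlarged to all indices, so that Parseval applies and one error
      bound serves both classes.\<close>
    have "(\<Sum>i\<in>?I. \<Sum>k\<in>?I. W i k * (l i - m k)\<^sup>2) \<le> (\<Sum>i = 1..n. \<Sum>k\<in>?I. W i k * (l i - m k)\<^sup>2)"
      by (intro sum_parity_class_le sum_nonneg mult_nonneg_nonneg W0) simp
    also have "\<dots> \<le> (\<Sum>i = 1..n. \<Sum>k = 1..n. W i k * (l i - m k)\<^sup>2)"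
      by (intro sum_mono sum_parity_class_le mult_nonneg_nonneg W0) simp
    also have "\<dots> = (\<Sum>k = 1..n. \<Sum>i = 1..n. W i k * (l i - m k)\<^sup>2)" by (rule sum.swap)
    also have "\<dots> = (\<Sum>k = 1..n. \<Sum>j = 1..n. (mult_vec n T (v k) j - m k * v k j)\<^sup>2)"
    proof (rule sum.cong[OF refl])
      fix k
      \<comment> \<open>The defect of \<open>v k\<close> as an eigenvector for \<open>m k\<close>.
        Moving \<open>T\<close> over to its eigenvector \<open>u i\<close> turns the coefficient of
        \<open>w\<close> along \<open>u i\<close> into \<open>(l i - m k)\<close> times
        \<open>dotp n (u i) (v k)\<close>.\<close>
      define w where "w = (\<lambda>j. 1 * mult_vec n T (v k) j + (- m k) * v k j)"
      have "W i k * (l i - m k)\<^sup>2 = (dotp n (u i) w)\<^sup>2" if "i \<in> {1..n}" for i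
      proof -
        have "dotp n (u i) (mult_vec n T (v k)) = dotp n (v k) (mult_vec n T (u i))"
          by (rule dotp_mult_vec_symmetric[OF sym])
        also have "\<dots> = dotp n (v k) (\<lambda>j. l i * u i j + 0 * u i j)"
          using eig that by (intro dotp_cong) auto
        also have "\<dots> = l i * dotp n (u i) (v k)"
          unfolding dotp_lincomb_right by (simp add: dotp_commute)
        finally have "dotp n (u i) w = (l i - m k) * dotp n (u i) (v k)"
          unfolding w_def dotp_lincomb_right by (simp add: algebra_simps)
        then show ?thesis by (simp add: W_def power_mult_distrib)
      qed
      then have "(\<Sum>i = 1..n. W i k * (l i - m k)\<^sup>2) = (\<Sum>i = 1..n. (dotp n (u i) w)\<^sup>2)"
        by (intro sum.cong refl)
      also have "\<dots> = dotp n w w" by (rule orthonormal_Parseval[OF u(1)])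
      also have "\<dots> = (\<Sum>j = 1..n. (mult_vec n T (v k) j - m k * v k j)\<^sup>2)"
        by (simp add: dotp_self w_def)
      finally show "(\<Sum>i = 1..n. W i k * (l i - m k)\<^sup>2) =
        (\<Sum>j = 1..n. (mult_vec n T (v k) j - m k * v k j)\<^sup>2)" .
    qed
    finally have b: "(\<Sum>i\<in>?I. \<Sum>k\<in>?I. W i k * (l i - m k)\<^sup>2) \<le>
        (\<Sum>k = 1..n. \<Sum>j = 1..n. (mult_vec n T (v k) j - m k * v k j)\<^sup>2)" .
    show ?thesis
      using a b L \<delta> by (intro mult_left_mono add_mono divide_right_mono) auto
  qed
  finally show ?thesis .
qed

section \<open>The discrete sine basis\<close>

definition node :: "nat \<Rightarrow> nat \<Rightarrow> real" where
  "node n k = real k * (pi / real (n + 1))"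

text \<open>The vectors of the discrete sine transform, which diagonalise the tridiagonal Toeplitz
  matrix with symbol \<open>cos\<close>.\<close>

definition sine_basis :: "nat \<Rightarrow> nat \<Rightarrow> nat \<Rightarrow> real" where
  "sine_basis n k j = sqrt (2 / real (n + 1)) * sin (real j * node n k)"

text \<open>The Dirichlet kernel, multiplied out: the factor \<open>2 * sin (x / 2)\<close> makes
  the sum telescope and no division by zero can occur.\<close>

lemma sum_cos_telescope:
  "2 * sin (x / 2) * (\<Sum>j = 0..n. cos (real j * x)) = sin ((real n + 1 / 2) * x) + sin (x / 2)"
proof (induction n)
  case (Suc n)
  have "2 * sin (x / 2) * cos ((real n + 1) * x) =
      sin ((real n + 1) * x + x / 2) - sin ((real n + 1) * x - x / 2)"
    by (simp add: sin_add sin_diff)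
  also have "(real n + 1) * x + x / 2 = (real (Suc n) + 1 / 2) * x" by (simp add: algebra_simps)
  also have "(real n + 1) * x - x / 2 = (real n + 1 / 2) * x" by (simp add: algebra_simps)
  finally show ?case using Suc by (simp add: algebra_simps)
qed simp

text \<open>The bound on \<open>m\<close> keeps \<open>node n m / 2\<close> strictly between 0 and
  \<open>pi\<close>, where the sine can be cancelled. As the value depends only on the parity of
  \<open>m\<close>, the frequencies \<open>k - l\<close> and \<open>k + l\<close> give equal sums,
  which is the orthogonality of the sine vectors.\<close>

lemma sum_cos_nodes:
  assumes "0 < m" "m < 2 * (n + 1)"
  shows "(\<Sum>j = 0..n. cos (real j * node n m)) = (1 - (-1) ^ m) / 2"
proof -
  let ?x = "node n m"
  have "real m * pi < (2 * (real n + 1)) * pi" using assms(2) by (intro mult_strict_right_mono) auto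
  then have "0 < ?x / 2" "?x / 2 < pi" using assms by (auto simp: node_def field_simps)
  then have s: "sin (?x / 2) > 0" by (rule sin_gt_zero)
  have "(real n + 1 / 2) * ?x = real m * pi - ?x / 2"
    by (simp add: node_def field_simps)
  then have "sin ((real n + 1 / 2) * ?x) = - ((-1) ^ m) * sin (?x / 2)"
    by (simp add: sin_diff)
  then have "2 * sin (?x / 2) * (\<Sum>j = 0..n. cos (real j * ?x)) = 2 * sin (?x / 2) * ((1 - (-1) ^ m) / 2)"
    unfolding sum_cos_telescope by (simp add: algebra_simps)
  then show ?thesis using s by simp
qed

lemma dotp_sine_basis:
  assumes "l \<le> k"
  shows "dotp n (sine_basis n k) (sine_basis n l) =
    ((\<Sum>j = 0..n. cos (real j * node n (k - l))) - (\<Sum>j = 0..n. cos (real j * node n (k + l)))) / real (n + 1)"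
proof -
  \<comment> \<open>The added term at \<open>j = 0\<close> vanishes.\<close>
  have "dotp n (sine_basis n k) (sine_basis n l) = (\<Sum>j = 0..n. sine_basis n k j * sine_basis n l j)"
    unfolding dotp_def by (rule sum.mono_neutral_left) (auto simp: sine_basis_def not_less_eq_eq)
  also have "\<dots> = (\<Sum>j = 0..n. (cos (real j * node n (k - l)) - cos (real j * node n (k + l))) / real (n + 1))"
  proof (intro sum.cong refl)
    fix j
    have "real j * node n (k - l) = real j * node n k - real j * node n l"
      "real j * node n (k + l) = real j * node n k + real j * node n l"
      using assms by (simp_all add: node_def of_nat_diff algebra_simps diff_divide_distrib add_divide_distrib)
    then have "cos (real j * node n (k - l)) - cos (real j * node n (k + l)) =
        2 * (sin (real j * node n k) * sin (real j * node n l))"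
      by (simp add: cos_add cos_diff)
    moreover have "sqrt (2 / real (n + 1)) * sqrt (2 / real (n + 1)) = 2 / real (n + 1)"
      unfolding real_sqrt_mult_self by simp
    moreover have "sine_basis n k j * sine_basis n l j =
        (sqrt (2 / real (n + 1)) * sqrt (2 / real (n + 1))) * (sin (real j * node n k) * sin (real j * node n l))"
      unfolding sine_basis_def by (simp only: mult_ac)
    ultimately show "sine_basis n k j * sine_basis n l j =
        (cos (real j * node n (k - l)) - cos (real j * node n (k + l))) / real (n + 1)"
      by simp
  qed
  also have "\<dots> = ((\<Sum>j = 0..n. cos (real j * node n (k - l))) - (\<Sum>j = 0..n. cos (real j * node n (k + l)))) / real (n + 1)"
    by (simp add: sum_subtractf sum_divide_distrib diff_divide_distrib)
  finally show ?thesis .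
qed

lemma orthonormal_sine_basis: "orthonormal n (sine_basis n)"
proof -
  have *: "dotp n (sine_basis n k) (sine_basis n l) = (if k = l then 1 else 0)"
    if "l \<le> k" "l \<in> {1..n}" "k \<in> {1..n}" for k l
  proof (cases "k = l")
    case True
    \<comment> \<open>The frequency \<open>2 * k\<close> is even, so its sum is 0, whereas the
      frequency 0 contributes \<open>n + 1\<close>.\<close>
    have "(\<Sum>j = 0..n. cos (real j * node n (k + l))) = 0"
      using that True by (subst sum_cos_nodes) auto
    then show ?thesis using True by (simp add: dotp_sine_basis node_def)
  next
    case False
    have "(-1) ^ (k + l) = ((-1) ^ (k - l) :: real)" using that(1) by (simp add: uminus_power_if)
    then have "(\<Sum>j = 0..n. cos (real j * node n (k - l))) = (\<Sum>j = 0..n. cos (real j * node n (k + l)))"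
      using that False by (subst (1 2) sum_cos_nodes) auto
    then show ?thesis using that False by (simp add: dotp_sine_basis)
  qed
  show ?thesis unfolding orthonormal_def
  proof (intro ballI)
    fix i k assume "i \<in> {1..n}" "k \<in> {1..n}"
    then show "dotp n (sine_basis n i) (sine_basis n k) = (if i = k then 1 else 0)"
      using *[of k i] *[of i k] dotp_commute[of n "sine_basis n i" "sine_basis n k"]
      by (cases "k \<le> i") auto
  qed
qed

lemma alternating_sine_basis: "alternating n (sine_basis n)"
  unfolding alternating_def
proof (intro ballI)
  fix i j assume "i \<in> {1..n}" "j \<in> {1..n}"
  then have "real (n + 1 - j) * node n i = real i * pi - real j * node n i"
    by (simp add: node_def of_nat_diff field_simps)
  then show "sine_basis n i (n + 1 - j) = (-1) ^ (i + 1) * sine_basis n i j"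
    by (simp add: sine_basis_def sin_diff)
qed

section \<open>Cosine coefficients and Toeplitz matrices on the half period\<close>

text \<open>A class of integrable functions that is closed under sums and products, so that
  integrability follows from closure rules alone.\<close>

definition bounded_measurable :: "(real \<Rightarrow> real) \<Rightarrow> bool" where
  "bounded_measurable g \<longleftrightarrow> g \<in> borel_measurable (lebesgue_on {0..pi}) \<and> bounded (g ` {0..pi})"

text \<open>The factor \<open>1 / pi\<close> on the half period matches \<open>1 / (2 * pi)\<close>
  on the full one, so these are the Fourier coefficients of the even extension.\<close>

definition cos_coeff :: "(real \<Rightarrow> real) \<Rightarrow> int \<Rightarrow> real" where
  "cos_coeff f k = (LINT t|lebesgue_on {0..pi}. f t * cos (of_int k * t)) / pi"

definition toeplitz_fun :: "(real \<Rightarrow> real) \<Rightarrow> nat \<Rightarrow> nat \<Rightarrow> real" where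
  "toeplitz_fun f i j = cos_coeff f (int i - int j)"

lemma bounded_measurableE:
  assumes "bounded_measurable g"
  obtains B where "\<And>t. t \<in> {0..pi} \<Longrightarrow> \<bar>g t\<bar> \<le> B"
proof -
  obtain B where "\<forall>y\<in>g ` {0..pi}. norm y \<le> B"
    using assms by (auto simp: bounded_measurable_def bounded_iff)
  then show thesis by (intro that[of B]) auto
qed

lemma bounded_measurable_integrable:
  assumes "bounded_measurable g"
  shows "integrable (lebesgue_on {0..pi}) g"
proof -
  interpret finite_measure "lebesgue_on {0..pi}"
    by (rule finite_measure_lebesgue_on) (metis cbox_interval lmeasurable_cbox)
  obtain B where "\<And>t. t \<in> {0..pi} \<Longrightarrow> \<bar>g t\<bar> \<le> B"
    using assms bounded_measurableE by blast
  then show ?thesis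
    using assms by (intro integrable_const_bound[of _ B]) (auto simp: bounded_measurable_def)
qed

lemma bounded_measurable_continuous:
  assumes "continuous_on {0..pi} g"
  shows "bounded_measurable g"
  using assms unfolding bounded_measurable_def
  by (auto intro!: continuous_imp_measurable_on_sets_lebesgue compact_imp_bounded compact_continuous_image)

lemma bounded_measurable_add:
  assumes "bounded_measurable f" "bounded_measurable g"
  shows "bounded_measurable (\<lambda>t. f t + g t)"
  using assms bounded_plus_comp[of f "{0..pi}" g]
  by (auto simp: bounded_measurable_def intro: borel_measurable_add)

lemma bounded_measurable_diff:
  assumes "bounded_measurable f" "bounded_measurable g"
  shows "bounded_measurable (\<lambda>t. f t - g t)"
  using assms bounded_minus_comp[of f "{0..pi}" g]
  by (auto simp: bounded_measurable_def intro: borel_measurable_diff)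

lemma bounded_measurable_mult:
  assumes "bounded_measurable f" "bounded_measurable g"
  shows "bounded_measurable (\<lambda>t. f t * g t)"
proof -
  obtain A where "\<And>t. t \<in> {0..pi} \<Longrightarrow> \<bar>f t\<bar> \<le> A" using assms(1) bounded_measurableE by blast
  moreover obtain B where "\<And>t. t \<in> {0..pi} \<Longrightarrow> \<bar>g t\<bar> \<le> B" using assms(2) bounded_measurableE by blast
  ultimately have "\<bar>f t * g t\<bar> \<le> A * B" if "t \<in> {0..pi}" for t
    unfolding abs_mult using that by (meson abs_ge_zero mult_mono order_trans)
  then have "bounded ((\<lambda>t. f t * g t) ` {0..pi})"
    unfolding bounded_iff by (intro exI[of _ "A * B"]) auto
  then show ?thesis using assms by (auto simp: bounded_measurable_def intro: borel_measurable_times)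
qed

lemma bounded_measurable_const: "bounded_measurable (\<lambda>t. c)"
  by (rule bounded_measurable_continuous) (rule continuous_on_const)

lemma bounded_measurable_cmult: "bounded_measurable f \<Longrightarrow> bounded_measurable (\<lambda>t. c * f t)"
  by (rule bounded_measurable_mult[OF bounded_measurable_const])

lemma bounded_measurable_power2: "bounded_measurable f \<Longrightarrow> bounded_measurable (\<lambda>t. (f t)\<^sup>2)"
  unfolding power2_eq_square by (rule bounded_measurable_mult)

lemma bounded_measurable_sum:
  "(\<And>i. i \<in> I \<Longrightarrow> bounded_measurable (f i)) \<Longrightarrow> bounded_measurable (\<lambda>t. \<Sum>i\<in>I. f i t)"
  by (induction I rule: infinite_finite_induct)
    (auto intro: bounded_measurable_add bounded_measurable_const)

lemma bounded_measurable_cos: "bounded_measurable (\<lambda>t. cos (a * t))"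
  by (intro bounded_measurable_continuous continuous_intros)

lemma bounded_measurable_sin: "bounded_measurable (\<lambda>t. sin (a * t))"
  by (intro bounded_measurable_continuous continuous_intros)

lemmas bounded_measurable_intros =
  bounded_measurable_add bounded_measurable_diff bounded_measurable_mult bounded_measurable_const
  bounded_measurable_power2 bounded_measurable_sum bounded_measurable_cos bounded_measurable_sin

lemma integral_cos:
  "(LINT t|lebesgue_on {0..pi}. cos (of_int k * t)) = (if k = 0 then pi else 0)"
proof (cases "k = 0")
  case True
  then show ?thesis by (simp add: measure_restrict_space)
next
  case False
  have "((\<lambda>t. cos (of_int k * t)) has_integral
      (sin (of_int k * pi) / of_int k - sin (of_int k * 0) / of_int k)) {0..pi}"
    using False
    by (intro fundamental_theorem_of_calculus)
      (auto intro!: derivative_eq_intros simp: has_real_derivative_iff_has_vector_derivative[symmetric])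
  moreover have "sin (of_int k * pi) = 0"
    using sin_integer_2pi sin_zero_iff_int2 by (metis)
  moreover have "(LINT t|lebesgue_on {0..pi}. cos (of_int k * t)) = integral {0..pi} (\<lambda>t. cos (of_int k * t))"
    by (intro lebesgue_integral_eq_integral bounded_measurable_integrable bounded_measurable_cos) auto
  ultimately show ?thesis using False by (simp add: integral_unique)
qed

lemma integral_cos_mult_cos:
  "(LINT t|lebesgue_on {0..pi}. cos (of_int k * t) * cos (of_int m * t)) =
    ((if k = m then pi else 0) + (if k = - m then pi else 0)) / 2"
proof -
  have "(LINT t|lebesgue_on {0..pi}. cos (of_int k * t) * cos (of_int m * t)) =
    (LINT t|lebesgue_on {0..pi}. (cos (of_int (k - m) * t) + cos (of_int (k + m) * t)) / 2)"
    by (intro Bochner_Integration.integral_cong refl) (simp add: cos_times_cos algebra_simps)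
  also have "\<dots> = ((LINT t|lebesgue_on {0..pi}. cos (of_int (k - m) * t)) +
      (LINT t|lebesgue_on {0..pi}. cos (of_int (k + m) * t))) / 2"
    unfolding integral_divide_zero
    by (intro arg_cong2[where f = "(/)"] refl Bochner_Integration.integral_add
        bounded_measurable_integrable bounded_measurable_cos)
  also have "\<dots> = ((if k = m then pi else 0) + (if k = - m then pi else 0)) / 2"
    unfolding integral_cos by (simp add: eq_neg_iff_add_eq_0)
  finally show ?thesis .
qed

lemma cos_coeff_minus: "cos_coeff f (- k) = cos_coeff f k"
  by (simp add: cos_coeff_def)

lemma cos_coeff_add:
  assumes "bounded_measurable f" "bounded_measurable g"
  shows "cos_coeff (\<lambda>t. f t + g t) k = cos_coeff f k + cos_coeff g k"
proof -
  have "(LINT t|lebesgue_on {0..pi}. (f t + g t) * cos (of_int k * t)) =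
    (LINT t|lebesgue_on {0..pi}. f t * cos (of_int k * t)) + (LINT t|lebesgue_on {0..pi}. g t * cos (of_int k * t))"
    unfolding distrib_right
    by (intro Bochner_Integration.integral_add bounded_measurable_integrable bounded_measurable_intros assms)
  then show ?thesis by (simp add: cos_coeff_def add_divide_distrib)
qed

text \<open>For \<open>m = 0\<close> both indicators are 1 at \<open>k = 0\<close>, so a constant
  \<open>c\<close> gets the coefficient \<open>c\<close> and not \<open>c / 2\<close>.\<close>

lemma cos_coeff_cos:
  "cos_coeff (\<lambda>t. c * cos (of_int m * t)) k =
    c / 2 * ((if k = m then 1 else 0) + (if k = - m then 1 else 0))"
proof -
  have "(LINT t|lebesgue_on {0..pi}. c * cos (of_int m * t) * cos (of_int k * t)) =
     c * (LINT t|lebesgue_on {0..pi}. cos (of_int k * t) * cos (of_int m * t))"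
    by (simp add: mult_ac)
  then show ?thesis by (auto simp: cos_coeff_def integral_cos_mult_cos)
qed

section \<open>Toeplitz matrices on the half period: symmetries, quadratic form, Frobenius
  norm\<close>

lemma symmetric_toeplitz_fun: "symmetric n (toeplitz_fun f)"
  unfolding symmetric_def toeplitz_fun_def using cos_coeff_minus[of f] by (metis minus_diff_eq)

lemma centrosymmetric_toeplitz_fun: "centrosymmetric n (toeplitz_fun f)"
  unfolding centrosymmetric_def toeplitz_fun_def
proof (intro ballI)
  fix i j assume "i \<in> {1..n}" "j \<in> {1..n}"
  then have "int (n + 1 - i) - int (n + 1 - j) = - (int i - int j)" by (simp add: of_nat_diff)
  then show "cos_coeff f (int (n + 1 - i) - int (n + 1 - j)) = cos_coeff f (int i - int j)"
    by (simp only: cos_coeff_minus)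
qed

text \<open>The squared modulus of the trigonometric polynomial with coefficients
  \<open>a j\<close>, in real form: the density against which the quadratic form of a Toeplitz
  matrix integrates the symbol.\<close>

definition trig_square :: "nat \<Rightarrow> (nat \<Rightarrow> real) \<Rightarrow> real \<Rightarrow> real" where
  "trig_square n a t = (\<Sum>j = 1..n. a j * cos (real j * t))\<^sup>2 + (\<Sum>j = 1..n. a j * sin (real j * t))\<^sup>2"

lemma trig_square_eq:
  "trig_square n a t = (\<Sum>i = 1..n. \<Sum>j = 1..n. a i * a j * cos (of_int (int i - int j) * t))"
proof -
  have *: "cos (of_int (int i - int j) * t) = cos (real i * t) * cos (real j * t) + sin (real i * t) * sin (real j * t)" for i j
    by (simp add: left_diff_distrib cos_diff)
  show ?thesis
    unfolding trig_square_def power2_eq_square sum_product sum.distrib[symmetric] * distrib_left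
    by (simp only: mult_ac)
qed

lemma bounded_measurable_trig_square: "bounded_measurable (trig_square n a)"
  unfolding trig_square_def by (intro bounded_measurable_intros)

lemma toeplitz_quadratic_form:
  assumes "bounded_measurable g"
  shows "dotp n a (mult_vec n (toeplitz_fun g) a) = (LINT t|lebesgue_on {0..pi}. g t * trig_square n a t) / pi"
proof -
  have "(LINT t|lebesgue_on {0..pi}. g t * trig_square n a t) =
     (LINT t|lebesgue_on {0..pi}. (\<Sum>i = 1..n. \<Sum>j = 1..n. a i * a j * (g t * cos (of_int (int i - int j) * t))))"
    unfolding trig_square_eq by (simp add: sum_distrib_left mult_ac)
  also have "\<dots> = (\<Sum>i = 1..n. (LINT t|lebesgue_on {0..pi}. (\<Sum>j = 1..n. a i * a j * (g t * cos (of_int (int i - int j) * t)))))"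
    by (intro Bochner_Integration.integral_sum bounded_measurable_integrable bounded_measurable_intros assms)
  also have "\<dots> = (\<Sum>i = 1..n. \<Sum>j = 1..n. (LINT t|lebesgue_on {0..pi}. a i * a j * (g t * cos (of_int (int i - int j) * t))))"
    by (intro sum.cong refl Bochner_Integration.integral_sum bounded_measurable_integrable bounded_measurable_intros assms)
  also have "\<dots> = (\<Sum>i = 1..n. \<Sum>j = 1..n. a i * (pi * (toeplitz_fun g i j * a j)))"
    by (simp add: toeplitz_fun_def cos_coeff_def mult_ac)
  also have "\<dots> = pi * dotp n a (mult_vec n (toeplitz_fun g) a)"
    by (simp add: dotp_def mult_vec_def sum_distrib_left mult_ac)
  finally show ?thesis by simp
qed

text \<open>The symbol 1 generates the identity matrix, so \<open>trig_square n a\<close> has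
  integral \<open>pi * dotp n a a\<close>; as it is nonnegative, bounds on the symbol pass to the
  form.\<close>

lemma toeplitz_quadratic_form_bounds:
  assumes g: "bounded_measurable g" and bd: "\<And>t. t \<in> {0..pi} \<Longrightarrow> \<alpha> \<le> g t \<and> g t \<le> \<beta>"
  shows "\<alpha> * dotp n a a \<le> dotp n a (mult_vec n (toeplitz_fun g) a)"
    and "dotp n a (mult_vec n (toeplitz_fun g) a) \<le> \<beta> * dotp n a a"
proof -
  have const: "(LINT t|lebesgue_on {0..pi}. c * trig_square n a t) = pi * (c * dotp n a a)" for c
  proof -
    have "toeplitz_fun (\<lambda>t. 1) = (\<lambda>i j. if i = j then 1 else 0)"
      unfolding toeplitz_fun_def cos_coeff_def mult_1 integral_cos by (intro ext) auto
    then have "mult_vec n (toeplitz_fun (\<lambda>t. 1)) a j = a j" if "j \<in> {1..n}" for j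
      using that by (simp add: mult_vec_def dotp_def if_distrib[of "\<lambda>x. x * _"] cong: if_cong)
    then have "dotp n a (mult_vec n (toeplitz_fun (\<lambda>t. 1)) a) = dotp n a a"
      by (intro dotp_cong) auto
    then show ?thesis
      using toeplitz_quadratic_form[OF bounded_measurable_const, of n a 1] by (simp add: field_simps)
  qed
  have ts: "trig_square n a t \<ge> 0" for t by (simp add: trig_square_def)
  have "pi * (\<alpha> * dotp n a a) \<le> (LINT t|lebesgue_on {0..pi}. g t * trig_square n a t)"
    unfolding const[symmetric] using bd ts
    by (intro integral_mono bounded_measurable_integrable bounded_measurable_mult bounded_measurable_const
        g bounded_measurable_trig_square mult_right_mono) auto
  then show "\<alpha> * dotp n a a \<le> dotp n a (mult_vec n (toeplitz_fun g) a)"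
    unfolding toeplitz_quadratic_form[OF g] by (simp add: field_simps)
  have "(LINT t|lebesgue_on {0..pi}. g t * trig_square n a t) \<le> pi * (\<beta> * dotp n a a)"
    unfolding const[symmetric] using bd ts
    by (intro integral_mono bounded_measurable_integrable bounded_measurable_mult bounded_measurable_const
        g bounded_measurable_trig_square mult_right_mono) auto
  then show "dotp n a (mult_vec n (toeplitz_fun g) a) \<le> \<beta> * dotp n a a"
    unfolding toeplitz_quadratic_form[OF g] by (simp add: field_simps)
qed

text \<open>The function \<open>q\<close> uses the coefficients \<open>c d\<close> themselves, half
  of those of the orthogonal projection when \<open>d > 0\<close>. This treats all \<open>d\<close>
  alike and loses only a constant: the squared norm of \<open>q\<close> is at most \<open>pi\<close>
  times the sum of squares, and expanding the integral of \<open>(g t - q t)\<^sup>2\<close> gives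
  the bound.\<close>

lemma Bessel_cos:
  assumes g: "bounded_measurable g"
  shows "(\<Sum>d<m. (cos_coeff g (int d))\<^sup>2) \<le> (LINT t|lebesgue_on {0..pi}. (g t)\<^sup>2) / pi"
proof -
  define c where "c d = cos_coeff g (int d)" for d
  define e where "e d t = cos (of_int (int d) * t)" for d :: nat and t :: real
  define q where "q t = (\<Sum>d<m. c d * e d t)" for t
  note bm = bounded_measurable_integrable bounded_measurable_intros bounded_measurable_cmult g
  have e: "bounded_measurable (e d)" for d unfolding e_def by (rule bounded_measurable_cos)
  have q: "bounded_measurable q" unfolding q_def by (intro bm e)
  have ge: "(LINT t|lebesgue_on {0..pi}. g t * e d t) = pi * c d" for d
    by (simp add: c_def cos_coeff_def e_def)
  have gq: "(LINT t|lebesgue_on {0..pi}. g t * q t) = pi * (\<Sum>d<m. (c d)\<^sup>2)"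
  proof -
    have "(LINT t|lebesgue_on {0..pi}. g t * q t) = (LINT t|lebesgue_on {0..pi}. (\<Sum>d<m. c d * (g t * e d t)))"
      by (simp add: q_def sum_distrib_left mult_ac)
    also have "\<dots> = (\<Sum>d<m. (LINT t|lebesgue_on {0..pi}. c d * (g t * e d t)))"
      by (intro Bochner_Integration.integral_sum bm e)
    also have "\<dots> = pi * (\<Sum>d<m. (c d)\<^sup>2)"
      by (simp add: ge sum_distrib_left power2_eq_square mult_ac)
    finally show ?thesis .
  qed
  \<comment> \<open>The squared norm of \<open>e d\<close> is \<open>pi\<close> for
    \<open>d = 0\<close> and \<open>pi / 2\<close> otherwise.\<close>
  have qe: "(LINT t|lebesgue_on {0..pi}. q t * e d t) = c d * ((pi + (if d = 0 then pi else 0)) / 2)"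
    if "d < m" for d
  proof -
    have "(LINT t|lebesgue_on {0..pi}. q t * e d t) = (LINT t|lebesgue_on {0..pi}. (\<Sum>k<m. c k * (e k t * e d t)))"
      unfolding q_def sum_distrib_right by (simp only: mult_ac)
    also have "\<dots> = (\<Sum>k<m. (LINT t|lebesgue_on {0..pi}. c k * (e k t * e d t)))"
      by (intro Bochner_Integration.integral_sum bm e)
    also have "\<dots> = (\<Sum>k<m. if k = d then c d * ((pi + (if d = 0 then pi else 0)) / 2) else 0)"
      unfolding e_def by (intro sum.cong refl) (auto simp: integral_cos_mult_cos simp del: of_int_of_nat_eq)
    also have "\<dots> = c d * ((pi + (if d = 0 then pi else 0)) / 2)" using that by simp
    finally show ?thesis .
  qed
  have "(LINT t|lebesgue_on {0..pi}. q t * q t) = (\<Sum>d<m. (LINT t|lebesgue_on {0..pi}. c d * (q t * e d t)))"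
  proof -
    have "(LINT t|lebesgue_on {0..pi}. q t * q t) = (LINT t|lebesgue_on {0..pi}. (\<Sum>d<m. c d * (q t * e d t)))"
      by (intro Bochner_Integration.integral_cong refl, subst (2) q_def) (simp add: sum_distrib_left mult_ac)
    also have "\<dots> = (\<Sum>d<m. (LINT t|lebesgue_on {0..pi}. c d * (q t * e d t)))"
      by (intro Bochner_Integration.integral_sum bm e q)
    finally show ?thesis .
  qed
  also have "\<dots> \<le> (\<Sum>d<m. pi * (c d)\<^sup>2)"
  proof (intro sum_mono)
    fix d assume "d \<in> {..<m}"
    then have "(LINT t|lebesgue_on {0..pi}. c d * (q t * e d t)) =
        (pi + (if d = 0 then pi else 0)) / 2 * (c d)\<^sup>2"
      by (simp add: qe power2_eq_square)
    also have "\<dots> \<le> pi * (c d)\<^sup>2" by (intro mult_right_mono) auto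
    finally show "(LINT t|lebesgue_on {0..pi}. c d * (q t * e d t)) \<le> pi * (c d)\<^sup>2" .
  qed
  finally have qq: "(LINT t|lebesgue_on {0..pi}. q t * q t) \<le> pi * (\<Sum>d<m. (c d)\<^sup>2)"
    by (simp add: sum_distrib_left)
  have "0 \<le> (LINT t|lebesgue_on {0..pi}. (g t - q t)\<^sup>2)" by (rule integral_nonneg_AE) simp
  also have "\<dots> = (LINT t|lebesgue_on {0..pi}. ((g t)\<^sup>2 - 2 * (g t * q t)) + q t * q t)"
    by (simp add: power2_eq_square algebra_simps)
  also have "\<dots> = (LINT t|lebesgue_on {0..pi}. (g t)\<^sup>2 - 2 * (g t * q t)) + (LINT t|lebesgue_on {0..pi}. q t * q t)"
    by (intro Bochner_Integration.integral_add bm q)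
  also have "(LINT t|lebesgue_on {0..pi}. (g t)\<^sup>2 - 2 * (g t * q t)) =
     (LINT t|lebesgue_on {0..pi}. (g t)\<^sup>2) - (LINT t|lebesgue_on {0..pi}. 2 * (g t * q t))"
    by (intro Bochner_Integration.integral_diff bm q)
  finally have "pi * (\<Sum>d<m. (c d)\<^sup>2) \<le> (LINT t|lebesgue_on {0..pi}. (g t)\<^sup>2)"
    using gq qq by simp
  then show ?thesis by (simp add: c_def field_simps)
qed

text \<open>The coefficients are even in their index, so each row consists of two runs of
  coefficients of nonnegative index, which share the diagonal entry. Bessel's inequality for each
  run yields the factor 2.\<close>

lemma toeplitz_Frobenius:
  assumes g: "bounded_measurable g"
  shows "(\<Sum>j = 1..n. \<Sum>i = 1..n. (toeplitz_fun g j i)\<^sup>2) \<le>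
    2 * real n / pi * (LINT t|lebesgue_on {0..pi}. (g t)\<^sup>2)"
proof -
  have "(\<Sum>i = 1..n. (toeplitz_fun g j i)\<^sup>2) \<le> 2 * ((LINT t|lebesgue_on {0..pi}. (g t)\<^sup>2) / pi)"
    if j: "j \<in> {1..n}" for j
  proof -
    have "(\<Sum>i = 1..n. (toeplitz_fun g j i)\<^sup>2) \<le>
      (\<Sum>i\<in>{1..j}. (toeplitz_fun g j i)\<^sup>2) + (\<Sum>i\<in>{j..n}. (toeplitz_fun g j i)\<^sup>2)"
    proof -
      have "{1..n} = {1..j} \<union> {j..n}" using j by auto
      then show ?thesis
        using sum.union_inter[of "{1..j}" "{j..n}" "\<lambda>i. (toeplitz_fun g j i)\<^sup>2"]
          sum_nonneg[of "{1..j} \<inter> {j..n}" "\<lambda>i. (toeplitz_fun g j i)\<^sup>2"] by simp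
    qed
    also have "(\<Sum>i\<in>{1..j}. (toeplitz_fun g j i)\<^sup>2) = (\<Sum>d<j. (cos_coeff g (int d))\<^sup>2)"
      by (rule sum.reindex_bij_witness[of _ "\<lambda>d. j - d" "\<lambda>i. j - i"])
        (auto simp: toeplitz_fun_def of_nat_diff)
    also have "(\<Sum>i\<in>{j..n}. (toeplitz_fun g j i)\<^sup>2) = (\<Sum>d<n + 1 - j. (cos_coeff g (int d))\<^sup>2)"
    proof (rule sum.reindex_bij_witness[of _ "\<lambda>d. j + d" "\<lambda>i. i - j"])
      fix i assume "i \<in> {j..n}"
      then have "int j - int i = - int (i - j)" by (simp add: of_nat_diff)
      then show "(cos_coeff g (int (i - j)))\<^sup>2 = (toeplitz_fun g j i)\<^sup>2"
        by (simp only: toeplitz_fun_def cos_coeff_minus)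
    qed (use j in auto)
    finally show ?thesis using Bessel_cos[OF g, of j] Bessel_cos[OF g, of "n + 1 - j"] by linarith
  qed
  then have "(\<Sum>j = 1..n. \<Sum>i = 1..n. (toeplitz_fun g j i)\<^sup>2) \<le>
      (\<Sum>j = 1..n. 2 * ((LINT t|lebesgue_on {0..pi}. (g t)\<^sup>2) / pi))" by (rule sum_mono)
  then show ?thesis by (simp add: mult_ac)
qed

section \<open>Cosine polynomials\<close>

inductive cos_poly :: "(real \<Rightarrow> real) \<Rightarrow> bool" where
  monom: "cos_poly (\<lambda>t. c * cos (of_int (int d) * t))"
| add: "cos_poly p \<Longrightarrow> cos_poly q \<Longrightarrow> cos_poly (\<lambda>t. p t + q t)"

lemma cos_poly_continuous: "cos_poly p \<Longrightarrow> continuous_on S p"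
  by (induction rule: cos_poly.induct) (auto intro!: continuous_intros)

lemma cos_poly_bounded_measurable: "cos_poly p \<Longrightarrow> bounded_measurable p"
  by (intro bounded_measurable_continuous cos_poly_continuous)

lemma cos_poly_mult_monom:
  assumes "cos_poly p"
  shows "cos_poly (\<lambda>t. p t * (c * cos (of_int (int d) * t)))"
  using assms
proof (induction rule: cos_poly.induct)
  case (monom b m)
  \<comment> \<open>The difference of the frequencies in absolute value: frequencies are natural
    numbers and the cosine is even.\<close>
  define l where "l = (if d \<le> m then m - d else d - m)"
  have "cos (of_int (int l) * t) = cos (of_int (int m) * t - of_int (int d) * t)" for t :: real
  proof (cases "d \<le> m")
    case False
    then have "real_of_int (int l) * t = - (of_int (int m) * t - of_int (int d) * t)"
      by (simp add: l_def of_nat_diff algebra_simps)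
    then show ?thesis by (simp only: cos_minus)
  qed (simp add: l_def of_nat_diff left_diff_distrib)
  then have l: "cos (of_int (int l) * t) = cos (of_int (int m) * t) * cos (of_int (int d) * t) +
      sin (of_int (int m) * t) * sin (of_int (int d) * t)" for t :: real
    by (simp only: cos_diff)
  have "cos (of_int (int (m + d)) * t) = cos (of_int (int m) * t + of_int (int d) * t)" for t :: real
    by (simp add: distrib_right)
  then have md: "cos (of_int (int (m + d)) * t) = cos (of_int (int m) * t) * cos (of_int (int d) * t) -
      sin (of_int (int m) * t) * sin (of_int (int d) * t)" for t :: real
    by (simp only: cos_add)
  have "(\<lambda>t. b * cos (of_int (int m) * t) * (c * cos (of_int (int d) * t))) =
    (\<lambda>t. (b * c / 2) * cos (of_int (int l) * t) + (b * c / 2) * cos (of_int (int (m + d)) * t))"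
    unfolding l md by (intro ext) (simp add: field_simps)
  then show ?case by (simp only: cos_poly.intros)
next
  case (add p q)
  from cos_poly.add[OF add.IH] show ?case by (simp only: distrib_right)
qed

lemma cos_poly_mult:
  assumes "cos_poly p" "cos_poly q"
  shows "cos_poly (\<lambda>t. p t * q t)"
  using assms(2)
proof (induction rule: cos_poly.induct)
  case (monom c d)
  show ?case by (rule cos_poly_mult_monom[OF assms(1)])
next
  case (add q r)
  from cos_poly.add[OF add.IH] show ?case by (simp only: distrib_left)
qed

text \<open>Stone-Weierstrass: the product-to-sum formula makes the cosine polynomials an algebra,
  and \<open>cos\<close> alone separates points because it is injective on the half period.\<close>

lemma cos_poly_dense:
  assumes "continuous_on {0..pi} g" "e > 0"
  obtains p where "cos_poly p" "\<And>t. t \<in> {0..pi} \<Longrightarrow> \<bar>g t - p t\<bar> < e"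
proof -
  interpret function_ring_on "Collect cos_poly" "{0..pi}"
  proof
    show "(\<lambda>_. c) \<in> Collect cos_poly" for c
      using cos_poly.monom[of c 0] by simp
    fix s t assume st: "s \<in> {0..pi}" "t \<in> {0..pi}" "s \<noteq> (t::real)"
    then have "cos s \<noteq> cos t" using cos_inj_pi[of s t] by auto
    then show "\<exists>f\<in>Collect cos_poly. f s \<noteq> f t"
      using cos_poly.monom[of 1 1] by (intro bexI[of _ cos]) auto
  qed (auto intro: cos_poly.add cos_poly_mult cos_poly_continuous)
  show thesis using Stone_Weierstrass_basic[OF assms] that by auto
qed

text \<open>The squared Frobenius norm of \<open>T S - S D\<close>, where \<open>S\<close> has the
  sine vectors as columns and \<open>D\<close> the values of \<open>p\<close> at the nodes on its
  diagonal. It is the error term of the eigenvalue comparison for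
  \<open>v = sine_basis n\<close>.\<close>

definition residual :: "nat \<Rightarrow> (real \<Rightarrow> real) \<Rightarrow> (real \<Rightarrow> real) \<Rightarrow> real" where
  "residual n f p = (\<Sum>k = 1..n. \<Sum>j = 1..n.
     (mult_vec n (toeplitz_fun f) (sine_basis n k) j - p (node n k) * sine_basis n k j)\<^sup>2)"

text \<open>Up to the factor \<open>c\<close>, the matrix averages the shifts by \<open>d\<close> in
  both directions, with 0 beyond the ends of the vector.\<close>

lemma mult_vec_toeplitz_cos:
  assumes j: "j \<in> {1..n}"
  shows "mult_vec n (toeplitz_fun (\<lambda>t. c * cos (of_int (int d) * t))) a j =
    c / 2 * ((if d < j then a (j - d) else 0) + (if j + d \<le> n then a (j + d) else 0))"
proof -
  have "mult_vec n (toeplitz_fun (\<lambda>t. c * cos (of_int (int d) * t))) a j =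
     (\<Sum>i = 1..n. c / 2 * ((if i = j - d then if d < j then a i else 0 else 0) + (if i = j + d then a i else 0)))"
    unfolding mult_vec_def dotp_def toeplitz_fun_def cos_coeff_cos
    by (intro sum.cong refl) auto
  also have "\<dots> = c / 2 * ((\<Sum>i = 1..n. if i = j - d then if d < j then a i else 0 else 0) +
      (\<Sum>i = 1..n. if i = j + d then a i else 0))"
    by (simp only: sum_distrib_left[symmetric] sum.distrib)
  also have "\<dots> = c / 2 * ((if d < j then a (j - d) else 0) + (if j + d \<le> n then a (j + d) else 0))"
    using j by (simp add: sum.delta) auto
  finally show ?thesis .
qed

text \<open>By the addition formula a sine vector is an exact eigenvector of the untruncated double
  shift. A defect occurs only in the at most \<open>d\<close> rows at each end where a shifted index
  leaves the range; \<open>2 * d\<close> rows of \<open>n\<close> squared entries of size at most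
  \<open>r\<close> give a bound free of \<open>n\<close>.\<close>

lemma residual_cos:
  defines "p d c \<equiv> \<lambda>t. c * cos (of_int (int d) * t)"
  shows "residual n (p d c) (p d c) \<le> 4 * real d * c\<^sup>2"
proof -
  define r where "r = 2 * c\<^sup>2 / real (n + 1)"
  have r: "r \<ge> 0" by (simp add: r_def)
  have entry: "(mult_vec n (toeplitz_fun (p d c)) (sine_basis n k) j - p d c (node n k) * sine_basis n k j)\<^sup>2
     \<le> (if j \<le> d then r else 0) + (if n < j + d then r else 0)" if j: "j \<in> {1..n}" for k j
  proof -
    \<comment> \<open>The sine vector extended to real positions, including the out-of-range ones
      \<open>j - d\<close> and \<open>j + d\<close>.\<close>
    define S where "S x = sqrt (2 / real (n + 1)) * sin (x * node n k)" for x
    have S2: "(S x)\<^sup>2 \<le> 2 / real (n + 1)" for x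
    proof -
      have "(S x)\<^sup>2 = 2 / real (n + 1) * (sin (x * node n k))\<^sup>2"
        by (simp add: S_def power_mult_distrib)
      also have "\<dots> \<le> 2 / real (n + 1) * 1"
        by (intro mult_left_mono) (simp_all add: abs_square_le_1)
      finally show ?thesis by simp
    qed
    \<comment> \<open>The shifted entries that truncation removes at the two ends.\<close>
    define a where "a = (if j \<le> d then S (real j - real d) else 0)"
    define b where "b = (if n < j + d then S (real j + real d) else 0)"
    have s: "sine_basis n k i = S (real i)" for i by (simp add: sine_basis_def S_def)
    have "S (real j - real d) + S (real j + real d) = 2 * (cos (of_int (int d) * node n k) * S (real j))"
      by (simp add: S_def left_diff_distrib distrib_right sin_add sin_diff algebra_simps)
    then have "p d c (node n k) * sine_basis n k j = c / 2 * (S (real j - real d) + S (real j + real d))"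
      by (simp add: p_def s)
    moreover have "mult_vec n (toeplitz_fun (p d c)) (sine_basis n k) j =
        c / 2 * ((if d < j then S (real j - real d) else 0) + (if j + d \<le> n then S (real j + real d) else 0))"
      unfolding p_def mult_vec_toeplitz_cos[OF j] s by (simp add: of_nat_diff)
    ultimately have "mult_vec n (toeplitz_fun (p d c)) (sine_basis n k) j - p d c (node n k) * sine_basis n k j
        = - (c / 2 * (a + b))"
      by (simp add: a_def b_def algebra_simps)
    then have "(mult_vec n (toeplitz_fun (p d c)) (sine_basis n k) j - p d c (node n k) * sine_basis n k j)\<^sup>2
        = c\<^sup>2 / 4 * (a + b)\<^sup>2"
      by (simp add: power_mult_distrib power_divide)
    also have "\<dots> \<le> c\<^sup>2 / 4 * (2 * a\<^sup>2 + 2 * b\<^sup>2)"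
      using sum_squares_bound[of a b] by (intro mult_left_mono) (simp_all add: power2_sum)
    also have "\<dots> = c\<^sup>2 / 2 * a\<^sup>2 + c\<^sup>2 / 2 * b\<^sup>2" by (simp add: algebra_simps)
    also have "\<dots> \<le> (if j \<le> d then r else 0) + (if n < j + d then r else 0)"
    proof (intro add_mono)
      have *: "c\<^sup>2 / 2 * (S x)\<^sup>2 \<le> r" for x
      proof -
        have "c\<^sup>2 / 2 * (S x)\<^sup>2 \<le> c\<^sup>2 / 2 * (2 / real (n + 1))"
          by (intro mult_left_mono S2) simp
        also have "\<dots> \<le> r" by (simp add: r_def field_simps)
        finally show ?thesis .
      qed
      show "c\<^sup>2 / 2 * a\<^sup>2 \<le> (if j \<le> d then r else 0)" using * by (simp add: a_def)
      show "c\<^sup>2 / 2 * b\<^sup>2 \<le> (if n < j + d then r else 0)" using * by (simp add: b_def)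
    qed
    finally show ?thesis .
  qed
  have "residual n (p d c) (p d c) \<le> (\<Sum>k = 1..n. \<Sum>j = 1..n. (if j \<le> d then r else 0) + (if n < j + d then r else 0))"
    unfolding residual_def by (intro sum_mono entry)
  also have "\<dots> \<le> (\<Sum>k = 1..n. real d * r + real d * r)"
  proof (intro sum_mono)
    have "(\<Sum>j = 1..n. if j \<le> d then r else 0) = real (card ({1..n} \<inter> {j. j \<le> d})) * r"
      by (simp add: sum.If_cases)
    also have "\<dots> \<le> real d * r"
      using card_mono[of "{1..d}" "{1..n} \<inter> {j. j \<le> d}"] by (intro mult_right_mono r) force+
    finally have 1: "(\<Sum>j = 1..n. if j \<le> d then r else 0) \<le> real d * r" .
    have "(\<Sum>j = 1..n. if n < j + d then r else 0) = real (card ({1..n} \<inter> {j. n < j + d})) * r"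
      by (simp add: sum.If_cases)
    also have "card ({1..n} \<inter> {j. n < j + d}) \<le> card {n + 1 - d..n}"
      by (intro card_mono) auto
    then have "real (card ({1..n} \<inter> {j. n < j + d})) * r \<le> real d * r"
      by (intro mult_right_mono r) auto
    finally have 2: "(\<Sum>j = 1..n. if n < j + d then r else 0) \<le> real d * r" .
    show "(\<Sum>j = 1..n. (if j \<le> d then r else 0) + (if n < j + d then r else 0)) \<le> real d * r + real d * r"
      unfolding sum.distrib by (rule add_mono[OF 1 2])
  qed
  also have "\<dots> = 4 * real d * c\<^sup>2 * (real n / real (n + 1))" by (simp add: r_def)
  also have "\<dots> \<le> 4 * real d * c\<^sup>2 * 1" by (intro mult_left_mono) auto
  finally show ?thesis by simp
qed

lemma double_sum_power2_add:
  "(\<Sum>k\<in>A. \<Sum>j\<in>B. (x k j + y k j :: real)\<^sup>2) \<le>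
    2 * (\<Sum>k\<in>A. \<Sum>j\<in>B. (x k j)\<^sup>2) + 2 * (\<Sum>k\<in>A. \<Sum>j\<in>B. (y k j)\<^sup>2)"
proof -
  have "(\<Sum>k\<in>A. \<Sum>j\<in>B. (x k j + y k j)\<^sup>2) \<le> (\<Sum>k\<in>A. \<Sum>j\<in>B. 2 * (x k j)\<^sup>2 + 2 * (y k j)\<^sup>2)"
  proof (intro sum_mono)
    fix k j
    show "(x k j + y k j)\<^sup>2 \<le> 2 * (x k j)\<^sup>2 + 2 * (y k j)\<^sup>2"
      using sum_squares_bound[of "x k j" "y k j"] by (simp add: power2_sum)
  qed
  then show ?thesis by (simp add: sum.distrib sum_distrib_left)
qed

lemma mult_vec_toeplitz_add:
  assumes "bounded_measurable f" "bounded_measurable g"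
  shows "mult_vec n (toeplitz_fun (\<lambda>t. f t + g t)) a j =
    mult_vec n (toeplitz_fun f) a j + mult_vec n (toeplitz_fun g) a j"
  by (simp add: mult_vec_def dotp_def toeplitz_fun_def cos_coeff_add[OF assms] distrib_right sum.distrib)

lemma residual_add:
  assumes "bounded_measurable f" "bounded_measurable g"
  shows "residual n (\<lambda>t. f t + g t) (\<lambda>t. p t + q t) \<le> 2 * residual n f p + 2 * residual n g q"
proof -
  have "residual n (\<lambda>t. f t + g t) (\<lambda>t. p t + q t) = (\<Sum>k = 1..n. \<Sum>j = 1..n.
     ((mult_vec n (toeplitz_fun f) (sine_basis n k) j - p (node n k) * sine_basis n k j) +
      (mult_vec n (toeplitz_fun g) (sine_basis n k) j - q (node n k) * sine_basis n k j))\<^sup>2)"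
    unfolding residual_def mult_vec_toeplitz_add[OF assms] by (simp add: algebra_simps)
  also have "\<dots> \<le> 2 * residual n f p + 2 * residual n g q"
    unfolding residual_def by (rule double_sum_power2_add)
  finally show ?thesis .
qed

text \<open>Boundedness in \<open>n\<close> is what counts: after division by \<open>n\<close> the
  residual of a fixed polynomial disappears.\<close>

lemma residual_cos_poly_bounded:
  assumes "cos_poly p"
  obtains C where "\<And>n. residual n p p \<le> C"
  using assms
proof (induction arbitrary: thesis rule: cos_poly.induct)
  case (monom c d)
  show ?case by (rule monom) (rule residual_cos)
next
  case (add p q)
  obtain C where C: "\<And>n. residual n p p \<le> C" using add.IH(1) by blast
  obtain D where D: "\<And>n. residual n q q \<le> D" using add.IH(2) by blast
  have "residual n (\<lambda>t. p t + q t) (\<lambda>t. p t + q t) \<le> 2 * C + 2 * D" for n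
    using residual_add[of p q n p q] add.hyps cos_poly_bounded_measurable C[of n] D[of n] by fastforce
  then show ?case by (rule add.prems)
qed

text \<open>For the zero diagonal the residual is the squared Frobenius norm taken in the sine
  basis, which Parseval identifies with the usual one row by row.\<close>

lemma residual_zero_symbol:
  assumes "bounded_measurable g"
  shows "residual n g (\<lambda>t. 0) \<le> 2 * real n / pi * (LINT t|lebesgue_on {0..pi}. (g t)\<^sup>2)"
proof -
  have "residual n g (\<lambda>t. 0) = (\<Sum>j = 1..n. \<Sum>k = 1..n. (dotp n (sine_basis n k) (toeplitz_fun g j))\<^sup>2)"
    unfolding residual_def by (subst sum.swap) (simp add: mult_vec_def dotp_commute)
  also have "\<dots> = (\<Sum>j = 1..n. \<Sum>i = 1..n. (toeplitz_fun g j i)\<^sup>2)"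
    by (simp only: orthonormal_Parseval[OF orthonormal_sine_basis] dotp_self)
  also have "\<dots> \<le> 2 * real n / pi * (LINT t|lebesgue_on {0..pi}. (g t)\<^sup>2)"
    by (rule toeplitz_Frobenius[OF assms])
  finally show ?thesis .
qed

text \<open>The symbol is split as \<open>p + (f - p)\<close>, with the first summand compared to
  \<open>p\<close> and the second to 0.\<close>

lemma residual_le:
  assumes f: "bounded_measurable f" and p: "cos_poly p"
  shows "residual n f p \<le> 4 * real n / pi * (LINT t|lebesgue_on {0..pi}. (f t - p t)\<^sup>2) + 2 * residual n p p"
proof -
  have bm: "bounded_measurable p" "bounded_measurable (\<lambda>t. f t - p t)"
    using f cos_poly_bounded_measurable[OF p] by (auto intro: bounded_measurable_diff)
  show ?thesis
    using residual_add[OF bm(2,1), of n "\<lambda>t. 0" p] residual_zero_symbol[OF bm(2), of n] by simp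
qed

section \<open>Approximation and Riemann sums\<close>

text \<open>The infimal convolution of \<open>f\<close> with \<open>m\<close> times the distance is
  \<open>m\<close>-Lipschitz. At a point of continuity it converges to \<open>f\<close>, because for
  large \<open>m\<close> the penalty outside a neighbourhood exceeds the oscillation of
  \<open>f\<close>, which is at most \<open>2 * M\<close>.\<close>

lemma Lipschitz_regularization:
  fixes f :: "real \<Rightarrow> real"
  assumes S: "S \<noteq> {}" and M: "\<And>s. s \<in> S \<Longrightarrow> \<bar>f s\<bar> \<le> M"
  defines "g m t \<equiv> (INF s\<in>S. f s + real m * \<bar>t - s\<bar>)"
  shows "continuous_on T (g m)"
    and "t \<in> S \<Longrightarrow> \<bar>g m t\<bar> \<le> M"
    and "t \<in> S \<Longrightarrow> continuous (at t within S) f \<Longrightarrow> (\<lambda>m. g m t) \<longlonglongrightarrow> f t"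
proof -
  have low: "- M \<le> f s + real m * \<bar>t - s\<bar>" if "s \<in> S" for m t s
  proof -
    have "0 \<le> real m * \<bar>t - s\<bar>" by simp
    then show ?thesis using M[OF that] by linarith
  qed
  have bdd: "bdd_below ((\<lambda>s. f s + real m * \<bar>t - s\<bar>) ` S)" for m t
    by (rule bdd_belowI2[where m = "- M"]) (rule low)
  have ge: "- M \<le> g m t" for m t
    unfolding g_def using low by (intro cINF_greatest[OF S]) auto
  have le: "g m t \<le> f s + real m * \<bar>t - s\<bar>" if "s \<in> S" for m t s
    unfolding g_def by (rule cINF_lower[OF bdd that])
  have lip: "g m t \<le> g m s + real m * \<bar>t - s\<bar>" for m t s
  proof -
    have "g m t - real m * \<bar>t - s\<bar> \<le> g m s"
      unfolding g_def[of m s]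
    proof (rule cINF_greatest[OF S])
      fix r assume "r \<in> S"
      then have "g m t \<le> f r + real m * \<bar>t - r\<bar>" by (rule le)
      also have "real m * \<bar>t - r\<bar> \<le> real m * (\<bar>t - s\<bar> + \<bar>s - r\<bar>)"
        by (intro mult_left_mono) auto
      finally show "g m t - real m * \<bar>t - s\<bar> \<le> f r + real m * \<bar>s - r\<bar>"
        by (simp add: distrib_left)
    qed
    then show ?thesis by simp
  qed
  have "(real m)-lipschitz_on T (g m)"
  proof (rule lipschitz_onI)
    fix s t
    show "dist (g m s) (g m t) \<le> real m * dist s t"
      using lip[of m s t] lip[of m t s] by (auto simp: dist_real_def abs_minus_commute abs_le_iff)
  qed simp
  then show "continuous_on T (g m)" by (rule lipschitz_on_continuous_on)
  have gf: "g m t \<le> f t" if "t \<in> S" for m t using le[OF that, of m t] by simp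
  show "\<bar>g m t\<bar> \<le> M" if "t \<in> S"
    using ge[of m t] gf[OF that, of m] M[OF that] by linarith
  show "(\<lambda>m. g m t) \<longlonglongrightarrow> f t" if t: "t \<in> S" and cont: "continuous (at t within S) f"
  proof (rule LIMSEQ_I)
    fix e :: real assume e: "e > 0"
    obtain d where d: "d > 0" "\<And>s. s \<in> S \<Longrightarrow> \<bar>s - t\<bar> < d \<Longrightarrow> \<bar>f s - f t\<bar> < e / 2"
      using cont e unfolding continuous_within_eps_delta dist_real_def
      by (metis half_gt_zero)
    \<comment> \<open>From this index on the penalty at distance \<open>d\<close> is at least
      \<open>2 * M\<close>.\<close>
    obtain N :: nat where N: "2 * M / d \<le> real N" using real_arch_simple by blast
    have "norm (g m t - f t) < e" if m: "m \<ge> N" for m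
    proof -
      have "f t - e / 2 \<le> g m t" unfolding g_def
      proof (rule cINF_greatest[OF S])
        fix s assume s: "s \<in> S"
        show "f t - e / 2 \<le> f s + real m * \<bar>t - s\<bar>"
        proof (cases "\<bar>s - t\<bar> < d")
          case True
          have "0 \<le> real m * \<bar>t - s\<bar>" by simp
          then show ?thesis using d(2)[OF s True] by linarith
        next
          case False
          have "2 * M / d \<le> real m" using N m by linarith
          then have "2 * M \<le> real m * d" using d(1) by (simp add: field_simps)
          also have "\<dots> \<le> real m * \<bar>t - s\<bar>" using False by (intro mult_left_mono) auto
          finally show ?thesis using M[OF s] M[OF t] e by linarith
        qed
      qed
      then show ?thesis using gf[OF t, of m] e by (simp add: abs_if)
    qed
    then show "\<exists>N. \<forall>m\<ge>N. norm (g m t - f t) < e" by blast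
  qed
qed

text \<open>The continuous regularisations converge to \<open>f\<close> almost everywhere, hence in
  L^2 by dominated convergence, and each of them is uniformly close to a cosine polynomial.\<close>

lemma cos_poly_L2_dense:
  assumes f: "bounded_measurable f"
    and cont: "AE t in lebesgue_on {0..pi}. continuous (at t within {0..pi}) f" and e: "e > 0"
  obtains p where "cos_poly p" "(LINT t|lebesgue_on {0..pi}. (f t - p t)\<^sup>2) \<le> e"
proof -
  obtain M where M: "\<And>t. t \<in> {0..pi} \<Longrightarrow> \<bar>f t\<bar> \<le> M" using f bounded_measurableE by blast
  define g where "g m t = (INF s\<in>{0..pi}. f s + real m * \<bar>t - s\<bar>)" for m t
  have ne: "{0..pi} \<noteq> {}" by simp
  have gc: "continuous_on {0..pi} (g m)" for m
    unfolding g_def using M by (intro Lipschitz_regularization(1)[OF ne]) auto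
  have gM: "\<bar>g m t\<bar> \<le> M" if "t \<in> {0..pi}" for m t
    unfolding g_def by (rule Lipschitz_regularization(2)[OF ne _ that]) (rule M)
  have glim: "(\<lambda>m. g m t) \<longlonglongrightarrow> f t" if "t \<in> {0..pi}" "continuous (at t within {0..pi}) f" for t
    unfolding g_def by (rule Lipschitz_regularization(3)[OF ne _ that]) (rule M)
  have g: "bounded_measurable (g m)" for m by (rule bounded_measurable_continuous[OF gc])
  have fg: "bounded_measurable (\<lambda>t. (f t - g m t)\<^sup>2)" for m
    by (intro bounded_measurable_power2 bounded_measurable_diff f g)
  have "(\<lambda>m. LINT t|lebesgue_on {0..pi}. (f t - g m t)\<^sup>2) \<longlonglongrightarrow> (LINT t|lebesgue_on {0..pi}. 0)"
  proof (rule integral_dominated_convergence[where w = "\<lambda>t. (2 * M)\<^sup>2"])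
    show "AE t in lebesgue_on {0..pi}. (\<lambda>m. (f t - g m t)\<^sup>2) \<longlonglongrightarrow> 0"
      using cont AE_space
    proof eventually_elim
      case (elim t)
      then have "(\<lambda>m. (f t - g m t)\<^sup>2) \<longlonglongrightarrow> (f t - f t)\<^sup>2"
        by (intro tendsto_intros glim) auto
      then show ?case by simp
    qed
    show "AE t in lebesgue_on {0..pi}. norm ((f t - g m t)\<^sup>2) \<le> (2 * M)\<^sup>2" for m
    proof (rule AE_I2)
      fix t assume "t \<in> space (lebesgue_on {0..pi})"
      then have t: "t \<in> {0..pi}" by simp
      have "\<bar>f t - g m t\<bar> \<le> 2 * M" using M[OF t] gM[OF t, of m] by linarith
      then have "\<bar>f t - g m t\<bar>\<^sup>2 \<le> (2 * M)\<^sup>2" by (intro power_mono) auto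
      then show "norm ((f t - g m t)\<^sup>2) \<le> (2 * M)\<^sup>2" by simp
    qed
    show "(\<lambda>t. (f t - g m t)\<^sup>2) \<in> borel_measurable (lebesgue_on {0..pi})" for m
      using fg by (simp add: bounded_measurable_def)
  qed (auto intro: bounded_measurable_integrable bounded_measurable_const)
  then have "(\<lambda>m. LINT t|lebesgue_on {0..pi}. (f t - g m t)\<^sup>2) \<longlonglongrightarrow> 0" by simp
  then have "eventually (\<lambda>m. (LINT t|lebesgue_on {0..pi}. (f t - g m t)\<^sup>2) < e / 4) sequentially"
    using e by (intro order_tendstoD) auto
  then obtain m where m: "(LINT t|lebesgue_on {0..pi}. (f t - g m t)\<^sup>2) < e / 4"
    by (auto simp: eventually_sequentially)
  \<comment> \<open>Chosen so that the contributions \<open>2 * (e / 4)\<close> and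
    \<open>2 * (h\<^sup>2 * pi)\<close> are \<open>e / 2\<close> each.\<close>
  define h where "h = sqrt (e / (4 * pi))"
  have h: "h > 0" "h\<^sup>2 * pi = e / 4" using e by (simp_all add: h_def)
  obtain p where p: "cos_poly p" "\<And>t. t \<in> {0..pi} \<Longrightarrow> \<bar>g m t - p t\<bar> < h"
    using cos_poly_dense[OF gc h(1)] by blast
  have "(LINT t|lebesgue_on {0..pi}. (f t - p t)\<^sup>2) \<le>
    (LINT t|lebesgue_on {0..pi}. 2 * (f t - g m t)\<^sup>2 + 2 * h\<^sup>2)"
  proof (rule integral_mono)
    show "integrable (lebesgue_on {0..pi}) (\<lambda>t. (f t - p t)\<^sup>2)"
      by (intro bounded_measurable_integrable bounded_measurable_power2 bounded_measurable_diff f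
          cos_poly_bounded_measurable p)
    show "integrable (lebesgue_on {0..pi}) (\<lambda>t. 2 * (f t - g m t)\<^sup>2 + 2 * h\<^sup>2)"
      by (intro bounded_measurable_integrable bounded_measurable_add bounded_measurable_cmult
          bounded_measurable_const fg)
    fix t assume "t \<in> space (lebesgue_on {0..pi})"
    then have "\<bar>g m t - p t\<bar> \<le> h" using p(2)[of t] by auto
    then have "\<bar>g m t - p t\<bar>\<^sup>2 \<le> h\<^sup>2" by (intro power_mono) auto
    moreover have "(f t - p t)\<^sup>2 = ((f t - g m t) + (g m t - p t))\<^sup>2" by simp
    moreover have "((f t - g m t) + (g m t - p t))\<^sup>2 \<le> 2 * (f t - g m t)\<^sup>2 + 2 * (g m t - p t)\<^sup>2"
      using sum_squares_bound[of "f t - g m t" "g m t - p t"] unfolding power2_sum by linarith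
    ultimately show "(f t - p t)\<^sup>2 \<le> 2 * (f t - g m t)\<^sup>2 + 2 * h\<^sup>2" by simp
  qed
  also have "\<dots> = 2 * (LINT t|lebesgue_on {0..pi}. (f t - g m t)\<^sup>2) + 2 * (h\<^sup>2 * pi)"
  proof -
    have "(LINT t|lebesgue_on {0..pi}. 2 * (f t - g m t)\<^sup>2 + 2 * h\<^sup>2) =
      (LINT t|lebesgue_on {0..pi}. 2 * (f t - g m t)\<^sup>2) + (LINT t|lebesgue_on {0..pi}. 2 * h\<^sup>2)"
      by (intro Bochner_Integration.integral_add bounded_measurable_integrable bounded_measurable_cmult
          bounded_measurable_const fg)
    then show ?thesis by (simp add: measure_restrict_space)
  qed
  also have "\<dots> \<le> e" using m h(2) e by simp
  finally show thesis using that p(1) by blast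
qed

text \<open>The cell of the index \<open>i\<close> has twice the width of the mesh, so that the cells of the indices
  of one parity are disjoint.\<close>

definition cell :: "nat \<Rightarrow> nat \<Rightarrow> real set" where
  "cell n i = {node n (i - 1)..<node n (i + 1)}"

text \<open>Its integral is a Riemann sum over one parity class, which reduces the convergence of
  such sums to dominated convergence.\<close>

definition cell_step :: "nat \<Rightarrow> bool \<Rightarrow> (nat \<Rightarrow> real) \<Rightarrow> real \<Rightarrow> real" where
  "cell_step n e a t = (\<Sum>i\<in>parity_class n e. a i * indicator (cell n i) t)"

lemma node_mono: "i \<le> j \<Longrightarrow> node n i \<le> node n j"
  by (simp add: node_def divide_right_mono mult_right_mono)

lemma node_nonneg: "0 \<le> node n i"
  by (simp add: node_def)

lemma node_last: "node n (n + 1) = pi"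
  by (simp add: node_def field_simps)

lemma cell_subset: "i \<in> {1..n} \<Longrightarrow> cell n i \<subseteq> {0..pi}"
  using node_mono[of "i + 1" "n + 1" n] node_nonneg[of n "i - 1"]
  unfolding node_last cell_def by force

lemma measure_cell:
  assumes "i \<in> {1..n}"
  shows "measure (lebesgue_on {0..pi}) (cell n i) = 2 * pi / real (n + 1)"
proof -
  have "measure (lebesgue_on {0..pi}) (cell n i) = measure lebesgue (cell n i)"
    using cell_subset[OF assms] by (intro measure_restrict_space) (auto simp: cell_def)
  also have "\<dots> = node n (i + 1) - node n (i - 1)"
    using node_mono[of "i - 1" "i + 1" n] by (simp add: cell_def)
  also have "\<dots> = 2 * pi / real (n + 1)"
    using assms by (simp add: node_def of_nat_diff diff_divide_distrib[symmetric] algebra_simps)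
  finally show ?thesis .
qed

lemma cell_sets: "cell n i \<inter> {0..pi} \<in> sets (lebesgue_on {0..pi})"
  by (auto simp: cell_def sets_restrict_space)

lemma cell_step_measurable: "cell_step n e a \<in> borel_measurable (lebesgue_on {0..pi})"
  unfolding cell_step_def
proof (intro borel_measurable_sum borel_measurable_times borel_measurable_const)
  fix i
  show "indicat_real (cell n i) \<in> borel_measurable (lebesgue_on {0..pi})"
    using cell_sets[of n i] by (simp add: borel_measurable_indicator_iff)
qed

lemma integral_cell_step:
  "(LINT t|lebesgue_on {0..pi}. cell_step n e a t) = (\<Sum>i\<in>parity_class n e. a i) * (2 * pi / real (n + 1))"
proof -
  have int: "bounded_measurable (indicator (cell n i))" for i
    using cell_sets[of n i]
    by (auto simp: bounded_measurable_def borel_measurable_indicator_iff bounded_iff indicator_def intro!: exI[of _ 1])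
  have "(LINT t|lebesgue_on {0..pi}. cell_step n e a t) =
     (\<Sum>i\<in>parity_class n e. (LINT t|lebesgue_on {0..pi}. a i * indicator (cell n i) t))"
    unfolding cell_step_def
    by (intro Bochner_Integration.integral_sum bounded_measurable_integrable bounded_measurable_cmult int)
  also have "\<dots> = (\<Sum>i\<in>parity_class n e. a i * (2 * pi / real (n + 1)))"
  proof (intro sum.cong refl)
    fix i assume "i \<in> parity_class n e"
    then have i: "i \<in> {1..n}" by (simp add: parity_class_def)
    then have "cell n i \<inter> space (lebesgue_on {0..pi}) = cell n i" using cell_subset by auto
    then show "(LINT t|lebesgue_on {0..pi}. a i * indicator (cell n i) t) = a i * (2 * pi / real (n + 1))"
      by (simp add: measure_cell[OF i])
  qed
  finally show ?thesis by (simp only: sum_distrib_right)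
qed

lemma cell_unique:
  assumes "t \<in> cell n i" "t \<in> cell n j" "i \<in> parity_class n e" "j \<in> parity_class n e"
  shows "i = j"
proof -
  have *: False if "t \<in> cell n i" "t \<in> cell n j" "i < j" "even i = even j" for i j
  proof -
    have "i + 1 \<noteq> j" using that(4) by auto
    then have "node n (i + 1) \<le> node n (j - 1)" using that(3) by (intro node_mono) auto
    then show False using that(1,2) by (auto simp: cell_def)
  qed
  show ?thesis using *[of i j] *[of j i] assms unfolding parity_class_def
    by (cases i j rule: linorder_cases) auto
qed

lemma cell_step_eq:
  assumes "i \<in> parity_class n e" "t \<in> cell n i"
  shows "cell_step n e a t = a i"
proof -
  have "cell_step n e a t = (\<Sum>j\<in>parity_class n e. if j = i then a i else 0)"
    unfolding cell_step_def
    using assms cell_unique by (intro sum.cong refl) (auto simp: indicator_def)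
  then show ?thesis using assms by simp
qed

lemma abs_cell_step_le:
  assumes "\<And>i. i \<in> {1..n} \<Longrightarrow> \<bar>a i\<bar> \<le> B" "B \<ge> 0"
  shows "\<bar>cell_step n e a t\<bar> \<le> B"
proof (cases "\<exists>i\<in>parity_class n e. t \<in> cell n i")
  case True
  then obtain i where i: "i \<in> parity_class n e" "t \<in> cell n i" by blast
  then have "i \<in> {1..n}" by (simp add: parity_class_def)
  then show ?thesis using cell_step_eq[OF i, of a] assms(1) by simp
next
  case False
  then have "cell_step n e a t = 0" unfolding cell_step_def by (intro sum.neutral) auto
  then show ?thesis using assms(2) by simp
qed

text \<open>If \<open>t\<close> lies between the nodes \<open>m\<close> and \<open>m + 1\<close>,
  the cells of both contain it, and one of the two indices has the required parity. The hypotheses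
  keep both indices in \<open>{1..n}\<close>.\<close>

lemma cell_exists:
  assumes "node n 1 \<le> t" "t < node n n"
  obtains i where "i \<in> parity_class n e" "t \<in> cell n i" "\<bar>node n i - t\<bar> \<le> pi / real (n + 1)"
proof -
  define h where "h = pi / real (n + 1)"
  have h: "h > 0" by (simp add: h_def)
  have node: "node n i = real i * h" for i by (simp add: node_def h_def)
  define m where "m = nat \<lfloor>t / h\<rfloor>"
  have "1 \<le> t / h" using assms(1) h by (simp add: node field_simps)
  then have "1 \<le> \<lfloor>t / h\<rfloor>" by (simp add: le_floor_iff)
  then have m1: "1 \<le> m" and m: "of_int \<lfloor>t / h\<rfloor> = real m" unfolding m_def by linarith+
  have "real m \<le> t / h" "t / h < real m + 1"
    using of_int_floor_le[of "t / h"] real_of_int_floor_add_one_gt[of "t / h"] unfolding m by auto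
  then have mt: "real m * h \<le> t" "t < (real m + 1) * h" using h by (simp_all add: field_simps)
  then have "real m * h < real n * h" using assms(2) node by simp
  then have mn: "m < n" using h by simp
  define i where "i = (if even m = e then m else m + 1)"
  have im: "i = m \<or> i = m + 1" by (simp add: i_def)
  show thesis
  proof
    show "i \<in> parity_class n e" using m1 mn by (auto simp: i_def parity_class_def)
    show "t \<in> cell n i"
    proof (cases "i = m")
      case True
      have "real (m - 1) * h \<le> real m * h" using h by (intro mult_right_mono) auto
      then have "real (m - 1) * h \<le> t" using mt(1) by (rule order_trans)
      then show ?thesis using True mt(2) by (simp add: cell_def node add.commute)
    next
      case False
      then have "i = m + 1" using im by simp
      moreover have "(real m + 1) * h \<le> real (m + 2) * h" using h by (intro mult_right_mono) auto
      ultimately show ?thesis using mt by (simp add: cell_def node algebra_simps)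
    qed
    show "\<bar>node n i - t\<bar> \<le> pi / real (n + 1)"
      unfolding h_def[symmetric] node using im mt by (auto simp: abs_le_iff algebra_simps)
  qed
qed

text \<open>The outermost mesh intervals are covered by one class only, so coverage by a given class
  holds eventually, for each interior point.\<close>

lemma eventually_cell:
  assumes "0 < t" "t < pi"
  shows "eventually (\<lambda>n. node n 1 \<le> t \<and> t < node n n) sequentially"
proof -
  have 0: "(\<lambda>n. pi / real (n + 1)) \<longlonglongrightarrow> 0"
    by (rule LIMSEQ_Suc[OF lim_const_over_n, unfolded Suc_eq_plus1])
  have "(\<lambda>n. pi - pi / real (n + 1)) \<longlonglongrightarrow> pi - 0" by (intro tendsto_intros 0)
  then have "eventually (\<lambda>n. t < pi - pi / real (n + 1)) sequentially"
    using assms(2) by (intro order_tendstoD) auto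
  moreover have "eventually (\<lambda>n. pi / real (n + 1) < t) sequentially"
    using 0 assms(1) by (intro order_tendstoD) auto
  ultimately show ?thesis
  proof eventually_elim
    case (elim n)
    moreover have "node n 1 = pi / real (n + 1)" by (simp add: node_def)
    moreover have "node n n = pi - pi / real (n + 1)" by (simp add: node_def field_simps)
    ultimately show ?case by simp
  qed
qed

lemma asymptotically_uniform_node: "asymptotically_uniform 0 pi (\<lambda>n. n) node"
proof -
  have "node n i \<in> {0..pi}" if "i \<in> {1..n}" for n i
    using that node_mono[of i "n + 1" n] node_nonneg[of n i] unfolding node_last by simp
  moreover have "(\<lambda>n. MAX i\<in>{1..n}. \<bar>node n i - (0 + real i * ((pi - 0) / real (n + 1)))\<bar>) \<longlonglongrightarrow> 0"
  proof (rule tendsto_eventually, rule eventually_mono[OF eventually_ge_at_top[of 1]])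
    fix n :: nat assume "1 \<le> n"
    then show "(MAX i\<in>{1..n}. \<bar>node n i - (0 + real i * ((pi - 0) / real (n + 1)))\<bar>) = 0"
      by (simp add: node_def)
  qed
  ultimately show ?thesis
    unfolding asymptotically_uniform_def using filterlim_ident by auto
qed

text \<open>At an interior point of continuity the step function eventually has a value
  \<open>g (x n i)\<close> with \<open>x n i\<close> within one mesh width plus the grid deviation
  of \<open>t\<close>, so it tends to \<open>g t\<close>. The grid points need not lie in the cells
  themselves.\<close>

lemma parity_Riemann_sum:
  assumes g: "bounded_measurable g"
    and cont: "AE t in lebesgue_on {0..pi}. continuous (at t within {0..pi}) g"
    and x: "asymptotically_uniform 0 pi (\<lambda>n. n) x"
  shows "(\<lambda>n. (\<Sum>i\<in>parity_class n e. g (x n i)) * (2 * pi / real (n + 1))) \<longlonglongrightarrow>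
    (LINT t|lebesgue_on {0..pi}. g t)"
proof -
  obtain M where M: "\<And>t. t \<in> {0..pi} \<Longrightarrow> \<bar>g t\<bar> \<le> M" using g bounded_measurableE by blast
  have M0: "M \<ge> 0" using M[of 0] by auto
  have xin: "x n i \<in> {0..pi}" if "i \<in> {1..n}" for n i
    using x that by (simp add: asymptotically_uniform_def)
  have xM: "\<bar>g (x n i)\<bar> \<le> M" if "i \<in> {1..n}" for n i using M xin that by blast
  have xlim: "(\<lambda>n. MAX i\<in>{1..n}. \<bar>x n i - node n i\<bar>) \<longlonglongrightarrow> 0"
    using x by (simp add: asymptotically_uniform_def node_def)
  have "(\<lambda>n. LINT t|lebesgue_on {0..pi}. cell_step n e (\<lambda>i. g (x n i)) t) \<longlonglongrightarrow>
    (LINT t|lebesgue_on {0..pi}. g t)"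
  proof (rule integral_dominated_convergence[where w = "\<lambda>t. M"])
    show "AE t in lebesgue_on {0..pi}. (\<lambda>n. cell_step n e (\<lambda>i. g (x n i)) t) \<longlonglongrightarrow> g t"
    proof -
      \<comment> \<open>The endpoints are discarded because the cells of a class need not cover
        them.\<close>
      have "AE t in lebesgue. t \<noteq> 0 \<and> t \<noteq> pi"
        using AE_not_in[of "{0, pi}" lebesgue] by (auto simp: negligible_iff_null_sets[symmetric])
      then have "AE t in lebesgue_on {0..pi}. t \<noteq> 0 \<and> t \<noteq> pi"
        by (simp add: AE_restrict_space_iff) (auto elim: eventually_mono)
      then show ?thesis using cont AE_space
      proof eventually_elim
        case (elim t)
        then have t: "t \<in> {0..pi}" "0 < t" "t < pi" by auto
        show ?case
        proof (rule LIMSEQ_I)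
          fix r :: real assume r: "r > 0"
          obtain d where d: "d > 0" "\<And>s. s \<in> {0..pi} \<Longrightarrow> \<bar>s - t\<bar> < d \<Longrightarrow> \<bar>g s - g t\<bar> < r"
            using elim(2) r unfolding continuous_within_eps_delta dist_real_def by metis
          have "(\<lambda>n. pi / real (n + 1)) \<longlonglongrightarrow> 0"
            by (rule LIMSEQ_Suc[OF lim_const_over_n, unfolded Suc_eq_plus1])
          then have "eventually (\<lambda>n. pi / real (n + 1) < d / 2) sequentially"
            using d(1) by (intro order_tendstoD) auto
          moreover have "eventually (\<lambda>n. (MAX i\<in>{1..n}. \<bar>x n i - node n i\<bar>) < d / 2) sequentially"
            using d(1) by (intro order_tendstoD[OF xlim]) auto
          moreover note eventually_cell[OF t(2,3)]
          ultimately have "eventually (\<lambda>n. norm (cell_step n e (\<lambda>i. g (x n i)) t - g t) < r) sequentially"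
          proof eventually_elim
            case (elim n)
            obtain i where i: "i \<in> parity_class n e" "t \<in> cell n i" "\<bar>node n i - t\<bar> \<le> pi / real (n + 1)"
              using cell_exists elim(3) by blast
            then have i1: "i \<in> {1..n}" by (simp add: parity_class_def)
            then have "\<bar>x n i - node n i\<bar> \<le> (MAX i\<in>{1..n}. \<bar>x n i - node n i\<bar>)"
              by (intro Max_ge) auto
            then have "\<bar>x n i - t\<bar> < d" using i(3) elim(1,2) by linarith
            then have "\<bar>g (x n i) - g t\<bar> < r" using d(2) xin[OF i1] by blast
            moreover have "cell_step n e (\<lambda>i. g (x n i)) t = g (x n i)"
              by (rule cell_step_eq[OF i(1,2)])
            ultimately show ?case by simp
          qed
          then show "\<exists>N. \<forall>n\<ge>N. norm (cell_step n e (\<lambda>i. g (x n i)) t - g t) < r"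
            by (simp add: eventually_sequentially)
        qed
      qed
    qed
    show "AE t in lebesgue_on {0..pi}. norm (cell_step n e (\<lambda>i. g (x n i)) t) \<le> M" for n
      using abs_cell_step_le[OF xM M0] by simp
    show "g \<in> borel_measurable (lebesgue_on {0..pi})" using g by (simp add: bounded_measurable_def)
    show "integrable (lebesgue_on {0..pi}) (\<lambda>t. M)"
      by (intro bounded_measurable_integrable bounded_measurable_const)
  qed (rule cell_step_measurable)
  then show ?thesis unfolding integral_cell_step .
qed

section \<open>Distribution of the eigenvalues\<close>

text \<open>Restricted to the complement of a null set, \<open>f\<close> is continuous and hence
  measurable; completeness of the measure carries this over to \<open>f\<close> itself.\<close>

lemma AE_continuous_imp_bounded_measurable:
  assumes cont: "AE t in lebesgue_on {0..pi}. continuous (at t within {0..pi}) f"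
    and bd: "bounded (f ` {0..pi})"
  shows "bounded_measurable f"
proof -
  have "AE t in lebesgue. t \<in> {0..pi} \<longrightarrow> continuous (at t within {0..pi}) f"
    using cont by (simp add: AE_restrict_space_iff)
  then obtain N where N: "N \<in> null_sets lebesgue"
    "\<And>t. t \<notin> N \<Longrightarrow> t \<in> {0..pi} \<Longrightarrow> continuous (at t within {0..pi}) f"
    unfolding completion.AE_iff_null_sets by auto
  define S where "S = {0..pi} - N"
  have S: "S \<in> sets lebesgue" using N(1) by (auto simp: S_def)
  have "continuous_on S f"
    unfolding continuous_on_eq_continuous_within
    using N(2) continuous_within_subset[of _ "{0..pi}" f S] by (auto simp: S_def)
  then have "f \<in> borel_measurable (lebesgue_on S)"
    using S by (rule continuous_imp_measurable_on_sets_lebesgue)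
  then have "(\<lambda>t. if t \<in> S then f t else 0) \<in> borel_measurable lebesgue"
    using S by (rule borel_measurable_if_I)
  moreover have "AE t in lebesgue. (if t \<in> S then f t else 0) = (if t \<in> {0..pi} then f t else 0)"
    using AE_not_in[OF N(1)] by eventually_elim (simp add: S_def)
  ultimately have "(\<lambda>t. if t \<in> {0..pi} then f t else 0) \<in> borel_measurable lebesgue"
    by (rule borel_measurable_AE)
  then show ?thesis using bd by (simp add: bounded_measurable_def borel_measurable_if_D)
qed

lemma fourier_coeff_even:
  assumes f: "bounded_measurable f" and even: "\<forall>t\<in>{-pi..pi}. f (- t) = f t"
  shows "fourier_coeff (\<lambda>t. complex_of_real (f t)) k = complex_of_real (cos_coeff f k)"
proof -
  \<comment> \<open>The value \<open>c = -1\<close> gives the integrand of the Fourier coefficient,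
    and \<open>c = 1\<close> what its negative half becomes under reflection.\<close>
  define E where "E c t = complex_of_real (f t) * exp (c * \<i> * of_int k * complex_of_real t)" for c t
  have E_eq: "E c t = of_real (f t * cos (of_int k * t)) + c * \<i> * of_real (f t * sin (of_int k * t))"
    if "c = 1 \<or> c = -1" for c t
    using that
  proof
    assume c: "c = 1"
    then have e: "exp (c * \<i> * of_int k * complex_of_real t) = cis (of_int k * t)"
      by (simp add: cis_conv_exp mult_ac)
    show ?thesis unfolding E_def e unfolding c by (simp add: complex_eq_iff)
  next
    assume c: "c = -1"
    then have e: "exp (c * \<i> * of_int k * complex_of_real t) = cis (- (of_int k * t))"
      by (simp add: cis_conv_exp mult_ac)
    show ?thesis unfolding E_def e unfolding c by (simp add: complex_eq_iff)
  qed
  have bm: "integrable (lebesgue_on {0..pi}) (\<lambda>t. f t * cos (of_int k * t))"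
    "integrable (lebesgue_on {0..pi}) (\<lambda>t. f t * sin (of_int k * t))"
    by (intro bounded_measurable_integrable bounded_measurable_mult f
        bounded_measurable_cos bounded_measurable_sin)+
  have intE: "integrable (lebesgue_on {0..pi}) (E c)" if "c = 1 \<or> c = -1" for c
    unfolding E_eq[OF that, abs_def]
    by (intro Bochner_Integration.integrable_add integrable_mult_right integrable_of_real bm)
  define G where "G c t = indicator {0..pi} t *\<^sub>R E c t" for c t
  \<comment> \<open>Half open, so that its reflection and \<open>{0..pi}\<close> split the full
    period without overlap at 0.\<close>
  define G' where "G' t = indicator {0<..pi} t *\<^sub>R E 1 t" for t
  have intG: "integrable lebesgue (G c)" if "c = 1 \<or> c = -1" for c
    using intE[OF that] unfolding G_def by (subst (asm) integrable_restrict_space) auto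
  have intG': "integrable lebesgue G'"
  proof -
    have "G' = (\<lambda>t. indicator {0<..pi} t *\<^sub>R G 1 t)"
      by (auto simp: G'_def G_def indicator_def)
    then show ?thesis using integrable_mult_indicator[OF _ intG[of 1]] by simp
  qed
  have LG': "(LINT t|lebesgue. G' t) = (LINT t|lebesgue. G 1 t)"
  proof (rule integral_cong_AE)
    have "AE t in lebesgue. t \<noteq> (0::real)"
      using AE_not_in[of "{0::real}" lebesgue] by (auto simp: negligible_iff_null_sets[symmetric])
    then show "AE t in lebesgue. G' t = G 1 t"
      by eventually_elim (auto simp: G'_def G_def indicator_def)
  qed (use intG intG' in \<open>auto intro: borel_measurable_integrable\<close>)
  have "has_bochner_integral lebesgue G' (LINT t|lebesgue. G' t)"
    using intG' by (rule has_bochner_integral_integrable)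
  then have "has_bochner_integral lebesgue (\<lambda>t. G' (- t)) (LINT t|lebesgue. G' t)"
    using has_bochner_integral_lebesgue_real_affine_iff[of "-1" G' _ 0] by simp
  then have reflect: "integrable lebesgue (\<lambda>t. G' (- t))"
    "(LINT t|lebesgue. G' (- t)) = (LINT t|lebesgue. G' t)"
    by (auto simp: has_bochner_integral_iff)
  have "(LINT t:{-pi..pi}|lebesgue. complex_of_real (f t) * exp (- \<i> * of_int k * complex_of_real t))
     = (LINT t|lebesgue. G (-1) t + G' (- t))"
    unfolding set_lebesgue_integral_def
  proof (rule Bochner_Integration.integral_cong[OF refl])
    fix t :: real
    show "indicator {-pi..pi} t *\<^sub>R (complex_of_real (f t) * exp (- \<i> * of_int k * complex_of_real t))
      = G (-1) t + G' (- t)"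
    proof (cases "t < 0")
      case True
      then show ?thesis using even by (auto simp: G_def G'_def E_def indicator_def)
    next
      case False
      then show ?thesis by (auto simp: G_def G'_def E_def indicator_def)
    qed
  qed
  also have "\<dots> = (LINT t|lebesgue. G (-1) t) + (LINT t|lebesgue. G 1 t)"
    using intG reflect LG' by simp
  also have "\<dots> = (LINT t|lebesgue_on {0..pi}. E (-1) t) + (LINT t|lebesgue_on {0..pi}. E 1 t)"
    unfolding G_def by (simp add: integral_restrict_space)
  also have "\<dots> = (LINT t|lebesgue_on {0..pi}. E (-1) t + E 1 t)"
    using intE by (simp add: Bochner_Integration.integral_add)
  also have "\<dots> = (LINT t|lebesgue_on {0..pi}. complex_of_real (2 * (f t * cos (of_int k * t))))"
    by (intro Bochner_Integration.integral_cong refl) (simp add: E_eq)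
  also have "\<dots> = complex_of_real (2 * (LINT t|lebesgue_on {0..pi}. f t * cos (of_int k * t)))"
    unfolding integral_complex_of_real by simp
  finally show ?thesis by (simp add: fourier_coeff_def cos_coeff_def)
qed

lemma bounded_measurable_Lipschitz_comp:
  assumes f: "bounded_measurable f" and lip: "\<And>a b. \<bar>\<phi> a - \<phi> b\<bar> \<le> L * \<bar>a - b\<bar>" and L: "L \<ge> 0"
  shows "bounded_measurable (\<lambda>t. \<phi> (f t))"
proof -
  have "L-lipschitz_on UNIV \<phi>"
    using lip L by (intro lipschitz_onI) (simp_all add: dist_real_def)
  then have "continuous_on UNIV \<phi>" by (rule lipschitz_on_continuous_on)
  then have "\<phi> \<in> borel_measurable borel" by (rule borel_measurable_continuous_onI)
  then have m: "(\<lambda>t. \<phi> (f t)) \<in> borel_measurable (lebesgue_on {0..pi})"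
    using f by (auto simp: bounded_measurable_def intro: measurable_compose)
  obtain M where M: "\<And>t. t \<in> {0..pi} \<Longrightarrow> \<bar>f t\<bar> \<le> M" using f bounded_measurableE by blast
  have "\<bar>\<phi> (f t)\<bar> \<le> \<bar>\<phi> 0\<bar> + L * M" if "t \<in> {0..pi}" for t
  proof -
    have "\<bar>\<phi> (f t) - \<phi> 0\<bar> \<le> L * \<bar>f t\<bar>" using lip[of "f t" 0] by simp
    also have "\<dots> \<le> L * M" using M[OF that] L by (intro mult_left_mono)
    finally show ?thesis by linarith
  qed
  then have "bounded ((\<lambda>t. \<phi> (f t)) ` {0..pi})"
    unfolding bounded_iff by (intro exI[of _ "\<bar>\<phi> 0\<bar> + L * M"]) auto
  then show ?thesis using m by (simp add: bounded_measurable_def)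
qed

lemma Lipschitz_comp_continuous:
  fixes \<phi> :: "real \<Rightarrow> real"
  assumes lip: "\<And>a b. \<bar>\<phi> a - \<phi> b\<bar> \<le> L * \<bar>a - b\<bar>" and L: "L \<ge> 0"
    and cont: "AE t in M. continuous (at t within S) f"
  shows "AE t in M. continuous (at t within S) (\<lambda>t. \<phi> (f t))"
proof -
  have "L-lipschitz_on UNIV \<phi>"
    using lip L by (intro lipschitz_onI) (simp_all add: dist_real_def)
  then have "continuous_on UNIV \<phi>" by (rule lipschitz_on_continuous_on)
  then have "isCont \<phi> a" for a by (simp add: continuous_on_eq_continuous_at)
  then show ?thesis
    using cont by (auto elim!: eventually_mono intro: continuous_within_compose3)
qed

text \<open>Three errors are added: eigenvalues against the values of \<open>p\<close> at the nodes,
  by the comparison within the class; the Riemann sum of these values against its integral; and this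
  integral against that of \<open>\<phi> (f t)\<close>.\<close>

lemma eigenvalue_distribution:
  assumes f: "bounded_measurable f"
    and cont: "AE t in lebesgue_on {0..pi}. continuous (at t within {0..pi}) f"
    and u: "\<And>n. n \<ge> 1 \<Longrightarrow> orthonormal n (u n)" "\<And>n. n \<ge> 1 \<Longrightarrow> alternating n (u n)"
    and eig: "\<And>n i j. n \<ge> 1 \<Longrightarrow> i \<in> {1..n} \<Longrightarrow> j \<in> {1..n} \<Longrightarrow>
      mult_vec n (toeplitz_fun f) (u n i) j = l n i * u n i j"
    and lip: "\<And>a b. \<bar>\<phi> a - \<phi> b\<bar> \<le> L * \<bar>a - b\<bar>" and L: "L \<ge> 0"
  shows "(\<lambda>n. (\<Sum>i\<in>parity_class n e. \<phi> (l n i)) * (2 * pi / real (n + 1))) \<longlonglongrightarrow>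
    (LINT t|lebesgue_on {0..pi}. \<phi> (f t))"
proof (rule LIMSEQ_I)
  fix r :: real assume r: "r > 0"
  \<comment> \<open>Up to a term of order \<open>1 / n\<close>, the first and third errors add up to
    \<open>L * (3 * pi * \<delta> + 9 * \<delta>)\<close>; \<open>L + 1\<close> guards against
    \<open>L = 0\<close>.\<close>
  define \<delta> where "\<delta> = r / (4 * (L + 1) * (3 * pi + 9))"
  have \<delta>: "\<delta> > 0" using r L by (simp add: \<delta>_def add_nonneg_pos)
  have small: "L * (3 * pi * \<delta> + 9 * \<delta>) < r / 4 + r / 4"
  proof -
    define K where "K = 3 * pi + 9"
    have "K > 0" by (simp add: K_def add_pos_pos)
    then have "L1 * (K * (r / (4 * L1 * K))) = r / 4" if "L1 > 0" for L1
      using that by simp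
    from this[of "L + 1"] have "(L + 1) * (K * \<delta>) = r / 4"
      using L unfolding \<delta>_def K_def[symmetric] by simp
    then have "(L + 1) * (3 * pi * \<delta> + 9 * \<delta>) = r / 4" by (simp add: K_def distrib_right)
    moreover have "L * (3 * pi * \<delta> + 9 * \<delta>) \<le> (L + 1) * (3 * pi * \<delta> + 9 * \<delta>)"
      using \<delta> by (intro mult_right_mono) auto
    ultimately show ?thesis using r by linarith
  qed
  \<comment> \<open>A squared L^2 error of \<open>\<delta>\<^sup>2\<close> is of order \<delta>
    again once the bound on absolute values divides it by \<delta>.\<close>
  obtain p where p: "cos_poly p" "(LINT t|lebesgue_on {0..pi}. (f t - p t)\<^sup>2) \<le> \<delta>\<^sup>2"
    using cos_poly_L2_dense[OF f cont, of "\<delta>\<^sup>2"] \<delta> by auto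
  obtain C where C: "\<And>n. residual n p p \<le> C" using residual_cos_poly_bounded[OF p(1)] by blast
  have pb: "bounded_measurable p" by (rule cos_poly_bounded_measurable[OF p(1)])
  define A where "A n = (\<Sum>i\<in>parity_class n e. \<phi> (l n i)) * (2 * pi / real (n + 1))" for n
  define B where "B n = (\<Sum>i\<in>parity_class n e. \<phi> (p (node n i))) * (2 * pi / real (n + 1))" for n
  define If where "If = (LINT t|lebesgue_on {0..pi}. \<phi> (f t))"
  define Ip where "Ip = (LINT t|lebesgue_on {0..pi}. \<phi> (p t))"
  have AB: "\<bar>A n - B n\<bar> \<le> L * (2 * pi * \<delta> + 8 * \<delta>) + (L * 4 * pi * C / \<delta>) / real n" if n: "n \<ge> 1" for n
  proof -
    have "residual n f p \<le> 4 * real n / pi * \<delta>\<^sup>2 + 2 * C"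
      using residual_le[OF f p(1), of n] C[of n] mult_left_mono[OF p(2), of "4 * real n / pi"] by simp
    then have res: "residual n f p / \<delta> \<le> (4 * real n / pi * \<delta>\<^sup>2 + 2 * C) / \<delta>"
      using \<delta> by (intro divide_right_mono) auto
    have C0: "C \<ge> 0" using C[of 0] by (simp add: residual_def)
    have "\<bar>(\<Sum>i\<in>parity_class n e. \<phi> (l n i)) - (\<Sum>i\<in>parity_class n e. \<phi> (p (node n i)))\<bar>
       \<le> L * (\<delta> * n + residual n f p / \<delta>)"
      unfolding residual_def
      by (rule eigenvalue_sum_comparison[OF symmetric_toeplitz_fun u(1)[OF n] u(2)[OF n]
            orthonormal_sine_basis alternating_sine_basis eig[OF n] lip L \<delta>])
    also have "\<dots> \<le> L * (\<delta> * n + (4 * real n / pi * \<delta>\<^sup>2 + 2 * C) / \<delta>)"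
      using res L by (intro mult_left_mono add_left_mono)
    also have "\<dots> = real n * (L * (\<delta> + 4 / pi * \<delta>)) + 2 * L * C / \<delta>"
      using \<delta> by (simp add: field_simps power2_eq_square)
    finally have *: "\<bar>(\<Sum>i\<in>parity_class n e. \<phi> (l n i)) - (\<Sum>i\<in>parity_class n e. \<phi> (p (node n i)))\<bar>
      \<le> real n * (L * (\<delta> + 4 / pi * \<delta>)) + 2 * L * C / \<delta>" .
    have "\<bar>A n - B n\<bar> = \<bar>(\<Sum>i\<in>parity_class n e. \<phi> (l n i)) - (\<Sum>i\<in>parity_class n e. \<phi> (p (node n i)))\<bar> * (2 * pi / real (n + 1))"
      unfolding A_def B_def left_diff_distrib[symmetric] abs_mult by simp
    also have "\<dots> \<le> (real n * (L * (\<delta> + 4 / pi * \<delta>)) + 2 * L * C / \<delta>) * (2 * pi / real (n + 1))"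
      using * by (intro mult_right_mono) auto
    also have "\<dots> \<le> (real n * (L * (\<delta> + 4 / pi * \<delta>)) + 2 * L * C / \<delta>) * (2 * pi / real n)"
      using n L \<delta> C0 by (intro mult_left_mono divide_left_mono add_nonneg_nonneg mult_nonneg_nonneg divide_nonneg_nonneg) auto
    also have "\<dots> = L * (2 * pi * \<delta> + 8 * \<delta>) + (L * 4 * pi * C / \<delta>) / real n"
      using n \<delta> by (simp add: field_simps)
    finally show ?thesis .
  qed
  have II: "\<bar>Ip - If\<bar> \<le> L * (pi * \<delta> + \<delta>)"
  proof -
    have bm: "bounded_measurable (\<lambda>t. \<phi> (f t))" "bounded_measurable (\<lambda>t. \<phi> (p t))"
      using bounded_measurable_Lipschitz_comp[OF _ lip L] f pb by blast+
    have "\<bar>Ip - If\<bar> = \<bar>LINT t|lebesgue_on {0..pi}. \<phi> (p t) - \<phi> (f t)\<bar>"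
      unfolding Ip_def If_def
      by (subst Bochner_Integration.integral_diff) (intro bounded_measurable_integrable bm refl)+
    also have "\<dots> \<le> (LINT t|lebesgue_on {0..pi}. \<bar>\<phi> (p t) - \<phi> (f t)\<bar>)"
      by (rule integral_abs_bound)
    also have "\<dots> \<le> (LINT t|lebesgue_on {0..pi}. L * (\<delta> + (f t - p t)\<^sup>2 * (1 / \<delta>)))"
    proof (rule integral_mono)
      show "integrable (lebesgue_on {0..pi}) (\<lambda>t. \<bar>\<phi> (p t) - \<phi> (f t)\<bar>)"
        by (intro integrable_abs bounded_measurable_integrable bounded_measurable_diff bm)
      show "integrable (lebesgue_on {0..pi}) (\<lambda>t. L * (\<delta> + (f t - p t)\<^sup>2 * (1 / \<delta>)))"
        by (intro bounded_measurable_integrable bounded_measurable_intros f pb)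
      fix t
      show "\<bar>\<phi> (p t) - \<phi> (f t)\<bar> \<le> L * (\<delta> + (f t - p t)\<^sup>2 * (1 / \<delta>))"
        using lip[of "p t" "f t"] mult_left_mono[OF abs_le_add_square_div[OF \<delta>, of "f t - p t"] L]
        by (simp add: abs_minus_commute)
    qed
    also have "\<dots> = L * (pi * \<delta> + (LINT t|lebesgue_on {0..pi}. (f t - p t)\<^sup>2) / \<delta>)"
    proof -
      have "(LINT t|lebesgue_on {0..pi}. \<delta> + (f t - p t)\<^sup>2 * (1 / \<delta>)) =
        (LINT t|lebesgue_on {0..pi}. \<delta>) + (LINT t|lebesgue_on {0..pi}. (f t - p t)\<^sup>2 * (1 / \<delta>))"
        by (intro Bochner_Integration.integral_add bounded_measurable_integrable bounded_measurable_intros f pb)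
      then show ?thesis by (simp add: measure_restrict_space)
    qed
    also have "\<dots> \<le> L * (pi * \<delta> + \<delta>\<^sup>2 / \<delta>)"
      using p(2) L \<delta> by (intro mult_left_mono add_left_mono divide_right_mono) auto
    finally show ?thesis using \<delta> by (simp add: power2_eq_square)
  qed
  have "B \<longlonglongrightarrow> Ip" unfolding B_def Ip_def
  proof (rule parity_Riemann_sum[OF _ _ asymptotically_uniform_node])
    show "bounded_measurable (\<lambda>t. \<phi> (p t))" by (rule bounded_measurable_Lipschitz_comp[OF pb lip L])
    show "AE t in lebesgue_on {0..pi}. continuous (at t within {0..pi}) (\<lambda>t. \<phi> (p t))"
      using cos_poly_continuous[OF p(1)]
      by (intro Lipschitz_comp_continuous[OF lip L] AE_I2) (auto simp: continuous_on_eq_continuous_within)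
  qed
  then have "eventually (\<lambda>n. \<bar>B n - Ip\<bar> < r / 4) sequentially"
    using LIMSEQ_D[of B Ip "r / 4"] r unfolding eventually_sequentially real_norm_def by simp
  moreover have "eventually (\<lambda>n. (L * 4 * pi * C / \<delta>) / real n < r / 4) sequentially"
    using r by (intro order_tendstoD(2)[OF lim_const_over_n]) auto
  moreover note eventually_ge_at_top[of 1]
  ultimately have "eventually (\<lambda>n. \<bar>A n - If\<bar> < r) sequentially"
  proof eventually_elim
    case (elim n)
    have "L * (2 * pi * \<delta> + 8 * \<delta>) + L * (pi * \<delta> + \<delta>) = L * (3 * pi * \<delta> + 9 * \<delta>)"
      by (simp add: algebra_simps)
    moreover have "\<bar>A n - If\<bar> \<le> \<bar>A n - B n\<bar> + \<bar>B n - Ip\<bar> + \<bar>Ip - If\<bar>" by linarith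
    ultimately show ?case using AB[OF elim(3)] II small elim(1,2) by linarith
  qed
  then show "\<exists>N. \<forall>n\<ge>N. norm ((\<Sum>i\<in>parity_class n e. \<phi> (l n i)) * (2 * pi / real (n + 1)) -
      (LINT t|lebesgue_on {0..pi}. \<phi> (f t))) < r"
    by (simp add: eventually_sequentially A_def If_def)
qed

section \<open>Matrix form\<close>

text \<open>The vectors are the columns; the shift by 1 translates 1-based vectors into 0-based
  matrix indices.\<close>

definition basis_mat :: "nat \<Rightarrow> (nat \<Rightarrow> nat \<Rightarrow> real) \<Rightarrow> complex mat" where
  "basis_mat n u = mat n n (\<lambda>(i, j). complex_of_real (u (j + 1) (i + 1)))"

lemma basis_mat_carrier [simp]: "basis_mat n u \<in> carrier_mat n n"
  by (simp add: basis_mat_def)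

lemma mat_adjoint_basis_mat: "mat_adjoint (basis_mat n u) = transpose_mat (basis_mat n u)"
  by (rule eq_matI) (simp_all add: mat_adjoint_def basis_mat_def mat_of_rows_def)

lemma sum_shift_index:
  fixes g :: "nat \<Rightarrow> 'a::comm_monoid_add"
  shows "(\<Sum>k\<in>{0..<n}. g (k + 1)) = (\<Sum>k = 1..n. g k)"
  using sum.shift_bounds_nat_ivl[of g 0 1 n] by (simp add: atLeastLessThanSuc_atLeastAtMost)

lemma real_unitary_basis_mat:
  assumes "orthonormal n u"
  shows "real_unitary_mat n (basis_mat n u)"
proof -
  let ?V = "basis_mat n u"
  have "transpose_mat ?V * ?V = 1\<^sub>m n"
  proof (rule eq_matI)
    fix i k assume ik: "i < dim_row (1\<^sub>m n :: complex mat)" "k < dim_col (1\<^sub>m n :: complex mat)"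
    then have "(transpose_mat ?V * ?V) $$ (i, k) = complex_of_real (dotp n (u (i + 1)) (u (k + 1)))"
      using sum_shift_index[of "\<lambda>m. complex_of_real (u (i + 1) m * u (k + 1) m)" n]
      by (simp add: basis_mat_def scalar_prod_def dotp_def)
    then show "(transpose_mat ?V * ?V) $$ (i, k) = 1\<^sub>m n $$ (i, k)"
      using assms ik by (simp add: orthonormal_def)
  qed (simp_all add: basis_mat_def)
  moreover from this have "?V * transpose_mat ?V = 1\<^sub>m n"
    using mat_mult_left_right_inverse[of "transpose_mat ?V" n ?V] by simp
  moreover have "elements_mat ?V \<subseteq> \<real>" by (auto simp: basis_mat_def)
  ultimately show ?thesis by (simp add: real_unitary_mat_def mat_adjoint_basis_mat)
qed

lemma diag1_carrier [simp]: "diag1 n d \<in> carrier_mat n n"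
  by (simp add: diag1_def)

text \<open>Similarity preserves the characteristic polynomial, so the diagonal lists the
  eigenvalues with algebraic multiplicity.\<close>

lemma real_unitary_diagonalization:
  assumes V: "real_unitary_mat n V" and A: "A \<in> carrier_mat n n" and AV: "A * V = V * diag1 n d"
  shows "A = V * diag1 n d * mat_adjoint V" and "eigenvalue_ordering n A d"
proof -
  have c: "V \<in> carrier_mat n n" "mat_adjoint V \<in> carrier_mat n n"
    using V by (auto simp: real_unitary_mat_def mat_adjoint_def)
  have VV: "V * mat_adjoint V = 1\<^sub>m n" "mat_adjoint V * V = 1\<^sub>m n"
    using V by (auto simp: real_unitary_mat_def)
  have "V * diag1 n d * mat_adjoint V = A * (V * mat_adjoint V)"
    using A c by (simp add: AV[symmetric] assoc_mult_mat[of _ n n _ n _ n])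
  then show eq: "A = V * diag1 n d * mat_adjoint V" using A by (simp add: VV)
  have "similar_mat_wit A (diag1 n d) V (mat_adjoint V)"
    using A c VV eq by (intro similar_mat_witI[of _ _ n]) auto
  then have "char_poly A = char_poly (diag1 n d)"
    by (intro char_poly_similar) (auto simp: similar_mat_def)
  also have "\<dots> = (\<Prod>a\<leftarrow>diag_mat (diag1 n d). [:- a, 1:])"
    by (rule char_poly_upper_triangular[of _ n]) (auto simp: diag1_def mat_diag_def)
  also have "diag_mat (diag1 n d) = map (\<lambda>i. d (i + 1)) [0..<n]"
    by (simp add: diag_mat_def diag1_def mat_diag_def)
  also have "(\<Prod>a\<leftarrow>map (\<lambda>i. d (i + 1)) [0..<n]. [:- a, 1:]) = (\<Prod>i\<in>{0..<n}. [:- d (i + 1), 1:])"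
    by (simp add: prod.distinct_set_conv_list[symmetric] comp_def)
  also have "\<dots> = (\<Prod>i = 1..n. [:- d i, 1:])"
    using prod.shift_bounds_nat_ivl[of "\<lambda>i. [:- d i, 1:]" 0 1 n]
    by (simp add: atLeastLessThanSuc_atLeastAtMost)
  finally show "eigenvalue_ordering n A d" by (simp add: eigenvalue_ordering_def)
qed

lemma toeplitz_mat_mult_basis:
  assumes T: "\<And>k. fourier_coeff F k = complex_of_real (cos_coeff f k)"
    and eig: "\<And>i j. i \<in> {1..n} \<Longrightarrow> j \<in> {1..n} \<Longrightarrow> mult_vec n (toeplitz_fun f) (u i) j = l i * u i j"
  shows "toeplitz_mat n F * basis_mat n u = basis_mat n u * diag1 n (\<lambda>i. complex_of_real (l i))"
proof (rule eq_matI)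
  fix i j assume "i < dim_row (basis_mat n u * diag1 n (\<lambda>i. complex_of_real (l i)))"
    "j < dim_col (basis_mat n u * diag1 n (\<lambda>i. complex_of_real (l i)))"
  then have ij: "i < n" "j < n" by (simp_all add: basis_mat_def diag1_def mat_diag_def)
  have "(toeplitz_mat n F * basis_mat n u) $$ (i, j) =
      (\<Sum>k\<in>{0..<n}. complex_of_real (toeplitz_fun f (i + 1) (k + 1) * u (j + 1) (k + 1)))"
    using ij by (simp add: toeplitz_mat_def basis_mat_def scalar_prod_def T toeplitz_fun_def)
  also have "\<dots> = complex_of_real (mult_vec n (toeplitz_fun f) (u (j + 1)) (i + 1))"
    using sum_shift_index[of "\<lambda>k. complex_of_real (toeplitz_fun f (i + 1) k * u (j + 1) k)" n]
    by (simp add: mult_vec_def dotp_def)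
  also have "\<dots> = (basis_mat n u * diag1 n (\<lambda>i. complex_of_real (l i))) $$ (i, j)"
    using ij eig[of "j + 1" "i + 1"] unfolding diag1_def
    by (subst mat_diag_mult_right[of _ n]) (simp_all add: basis_mat_def mult.commute)
  finally show "(toeplitz_mat n F * basis_mat n u) $$ (i, j) =
    (basis_mat n u * diag1 n (\<lambda>i. complex_of_real (l i))) $$ (i, j)" .
qed (simp_all add: toeplitz_mat_def basis_mat_def diag1_def mat_diag_def)

lemma exchange_mat_mult_basis:
  assumes "alternating n u"
  shows "exchange_mat n * basis_mat n u = basis_mat n u * diag1 n (\<lambda>i. (-1) ^ (i + 1))"
proof (rule eq_matI)
  fix i j assume "i < dim_row (basis_mat n u * diag1 n (\<lambda>i. (-1) ^ (i + 1)))"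
    "j < dim_col (basis_mat n u * diag1 n (\<lambda>i. (-1) ^ (i + 1)))"
  then have ij: "i < n" "j < n" by (simp_all add: basis_mat_def diag1_def mat_diag_def)
  have "(exchange_mat n * basis_mat n u) $$ (i, j) =
      (\<Sum>k\<in>{0..<n}. (if i + k + 1 = n then 1 else 0) * complex_of_real (u (j + 1) (k + 1)))"
    using ij by (simp add: exchange_mat_def basis_mat_def scalar_prod_def)
  also have "\<dots> = (\<Sum>k\<in>{0..<n}. if k = n - 1 - i then complex_of_real (u (j + 1) (k + 1)) else 0)"
    using ij by (intro sum.cong refl) auto
  also have "\<dots> = complex_of_real (u (j + 1) (n + 1 - (i + 1)))"
    using ij by (simp add: Suc_diff_Suc)
  also have "\<dots> = complex_of_real ((-1) ^ (j + 1 + 1) * u (j + 1) (i + 1))"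
  proof -
    have "u (j + 1) (n + 1 - (i + 1)) = (-1) ^ (j + 1 + 1) * u (j + 1) (i + 1)"
      using assms ij unfolding alternating_def by (elim ballE[of _ _ "j + 1"] ballE[of _ _ "i + 1"]) auto
    then show ?thesis by (simp only:)
  qed
  also have "\<dots> = (basis_mat n u * diag1 n (\<lambda>i. (-1) ^ (i + 1))) $$ (i, j)"
    using ij unfolding diag1_def
    by (subst mat_diag_mult_right[of _ n]) (simp_all add: basis_mat_def mult.commute)
  finally show "(exchange_mat n * basis_mat n u) $$ (i, j) =
    (basis_mat n u * diag1 n (\<lambda>i. (-1) ^ (i + 1))) $$ (i, j)" .
qed (simp_all add: exchange_mat_def basis_mat_def diag1_def mat_diag_def)

lemma diag1_mult: "diag1 n a * diag1 n b = diag1 n (\<lambda>i. a i * b i)"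
  by (simp add: diag1_def)

lemma flipped_toeplitz_mat_mult_basis:
  assumes TV: "toeplitz_mat n F * basis_mat n u = basis_mat n u * diag1 n d"
    and "alternating n u"
  shows "flipped_toeplitz_mat n F * basis_mat n u = basis_mat n u * diag1 n (\<lambda>i. (-1) ^ (i + 1) * d i)"
proof -
  have c: "exchange_mat n \<in> carrier_mat n n" "toeplitz_mat n F \<in> carrier_mat n n"
    by (simp_all add: exchange_mat_def toeplitz_mat_def)
  have "flipped_toeplitz_mat n F * basis_mat n u = exchange_mat n * (basis_mat n u * diag1 n d)"
    using c by (simp add: flipped_toeplitz_mat_def TV[symmetric] assoc_mult_mat[of _ n n _ n _ n])
  also have "\<dots> = (exchange_mat n * basis_mat n u) * diag1 n d"
    using c by (simp add: assoc_mult_mat[of _ n n _ n _ n])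
  also have "\<dots> = basis_mat n u * (diag1 n (\<lambda>i. (-1) ^ (i + 1)) * diag1 n d)"
    unfolding exchange_mat_mult_basis[OF assms(2)] by (rule assoc_mult_mat[of _ n n _ n _ n]) simp_all
  finally show ?thesis by (simp only: diag1_mult)
qed

section \<open>Uniform comparison of similarly ordered families\<close>

text \<open>A Lipschitz substitute for the indicator of \<open>{..t}\<close>, evaluated at
  \<open>s\<close> and falling from 1 to 0 between \<open>t\<close> and \<open>t + h\<close>: the
  distribution result admits only Lipschitz test functions.\<close>

definition ramp :: "real \<Rightarrow> real \<Rightarrow> real \<Rightarrow> real" where
  "ramp h t s = max 0 (min 1 ((t + h - s) / h))"

lemma ramp_Lipschitz:
  assumes "h > 0"
  shows "\<bar>ramp h t a - ramp h t b\<bar> \<le> 1 / h * \<bar>a - b\<bar>"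
proof -
  have "\<bar>max 0 (min 1 x) - max 0 (min 1 y)\<bar> \<le> \<bar>x - y\<bar>" for x y :: real by linarith
  then have "\<bar>ramp h t a - ramp h t b\<bar> \<le> \<bar>(t + h - a) / h - (t + h - b) / h\<bar>"
    unfolding ramp_def .
  also have "(t + h - a) / h - (t + h - b) / h = (b - a) / h" by (simp add: diff_divide_distrib)
  finally show ?thesis using assms by (simp add: abs_minus_commute)
qed

lemma ramp_bounds: "0 \<le> ramp h t s" "ramp h t s \<le> 1"
  by (auto simp: ramp_def)

lemma ramp_eq_1: "h > 0 \<Longrightarrow> s \<le> t \<Longrightarrow> ramp h t s = 1"
  by (simp add: ramp_def)

lemma ramp_eq_0: "h > 0 \<Longrightarrow> t + h \<le> s \<Longrightarrow> ramp h t s = 0"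
  by (simp add: ramp_def divide_nonpos_pos)

text \<open>For \<open>s \<le> z\<close> the ramp at \<open>z\<close> is 1 and the one at
  \<open>z - h\<close> at most 1/2; for \<open>s > z\<close> they are at least 1/2 and equal to
  0.\<close>

lemma ramp_diff_ge:
  assumes "h > 0" "\<bar>s - z\<bar> < h / 2"
  shows "1 / 2 \<le> ramp h z s - ramp h (z - h) s"
proof (cases "s \<le> z")
  case True
  have "z - s \<le> h / 2" using assms(2) by linarith
  then have "(z - h + h - s) / h \<le> 1 / 2" using assms(1) by (simp add: field_simps)
  then have "ramp h (z - h) s \<le> 1 / 2" unfolding ramp_def by linarith
  then show ?thesis using ramp_eq_1[OF assms(1) True] by simp
next
  case False
  have "h / 2 \<le> z + h - s" using assms(2) by linarith
  then have "1 / 2 \<le> (z + h - s) / h" using assms(1) by (simp add: field_simps)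
  then have "1 / 2 \<le> ramp h z s" unfolding ramp_def by linarith
  then show ?thesis using ramp_eq_0[OF assms(1), of "z - h" s] False by simp
qed

lemma ramp_mono: "h > 0 \<Longrightarrow> t \<le> t' \<Longrightarrow> ramp h t s \<le> ramp h t' s"
proof -
  assume "h > 0" "t \<le> t'"
  then have "(t + h - s) / h \<le> (t' + h - s) / h" by (intro divide_right_mono) auto
  then show ?thesis unfolding ramp_def by linarith
qed

text \<open>The two ramps are ordered pointwise and differ by at least 1/2 on a set of positive
  measure. In this way the essential range excludes flat stretches of the limiting
  distribution.\<close>

lemma integral_ramp_strict_mono:
  assumes f: "bounded_measurable f" and h: "h > 0"
    and pos: "emeasure lebesgue {t \<in> {0..pi}. \<bar>f t - z\<bar> < h / 2} > 0"
  shows "(LINT t|lebesgue_on {0..pi}. ramp h (z - h) (f t)) < (LINT t|lebesgue_on {0..pi}. ramp h z (f t))"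
proof -
  define S where "S = {t \<in> {0..pi}. \<bar>f t - z\<bar> < h / 2}"
  have bm: "bounded_measurable (\<lambda>t. ramp h a (f t))" for a
    using h by (intro bounded_measurable_Lipschitz_comp[OF f ramp_Lipschitz[OF h]]) simp
  have fm: "f \<in> borel_measurable (lebesgue_on {0..pi})" using f by (simp add: bounded_measurable_def)
  have "S = {t \<in> space (lebesgue_on {0..pi}). \<bar>f t - z\<bar> < h / 2}" by (simp add: S_def)
  also have "\<dots> \<in> sets (lebesgue_on {0..pi})" using fm by measurable
  finally have S: "S \<in> sets (lebesgue_on {0..pi})" .
  have Sbm: "bounded_measurable (indicat_real S)"
    using S by (auto simp: bounded_measurable_def bounded_iff indicator_def intro!: exI[of _ 1] borel_measurable_indicator)
  have "emeasure (lebesgue_on {0..pi}) S = emeasure lebesgue S"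
    by (intro emeasure_restrict_space) (auto simp: S_def)
  moreover interpret finite_measure "lebesgue_on {0..pi}"
    by (rule finite_measure_lebesgue_on) (metis cbox_interval lmeasurable_cbox)
  have "emeasure (lebesgue_on {0..pi}) S = ennreal (measure (lebesgue_on {0..pi}) S)"
    by (rule emeasure_eq_measure)
  ultimately have "measure (lebesgue_on {0..pi}) S > 0"
    using pos by (simp add: S_def)
  moreover have "(LINT t|lebesgue_on {0..pi}. 1 / 2 * indicat_real S t) = 1 / 2 * measure (lebesgue_on {0..pi}) S"
  proof -
    have "S \<inter> {0..pi} = S" by (auto simp: S_def)
    then show ?thesis by simp
  qed
  moreover have "(LINT t|lebesgue_on {0..pi}. 1 / 2 * indicat_real S t) \<le>
    (LINT t|lebesgue_on {0..pi}. ramp h z (f t) - ramp h (z - h) (f t))"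
  proof (rule integral_mono)
    fix t
    show "1 / 2 * indicat_real S t \<le> ramp h z (f t) - ramp h (z - h) (f t)"
      using ramp_diff_ge[OF h, of "f t" z] ramp_mono[OF h, of "z - h" z "f t"] h
      by (cases "t \<in> S") (auto simp: S_def indicator_def)
  qed (intro bounded_measurable_integrable bounded_measurable_cmult bounded_measurable_diff bm Sbm)+
  moreover have "(LINT t|lebesgue_on {0..pi}. ramp h z (f t) - ramp h (z - h) (f t)) =
    (LINT t|lebesgue_on {0..pi}. ramp h z (f t)) - (LINT t|lebesgue_on {0..pi}. ramp h (z - h) (f t))"
    by (intro Bochner_Integration.integral_diff bounded_measurable_integrable bm)
  ultimately show ?thesis by linarith
qed

text \<open>The essential range speaks of the full period, where by evenness the set in question is
  covered by its part in the half period and the reflection of that part; if the part were null, so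
  would be the whole.\<close>

lemma emeasure_half_pos:
  assumes even: "\<forall>t\<in>{-pi..pi}. f (- t) = (f t :: real)"
    and ess: "complex_of_real z \<in> essential_range {-pi..pi} (\<lambda>t. complex_of_real (f t))" and e: "e > 0"
    and f: "bounded_measurable f"
  shows "emeasure lebesgue {t \<in> {0..pi}. \<bar>f t - z\<bar> < e} > 0"
proof (rule ccontr)
  define S where "S = {t \<in> {0..pi}. \<bar>f t - z\<bar> < e}"
  assume "\<not> ?thesis"
  then have "emeasure lebesgue S = 0" by (simp add: S_def)
  moreover have "S \<in> sets lebesgue"
  proof -
    have "f \<in> borel_measurable (lebesgue_on {0..pi})" using f by (simp add: bounded_measurable_def)
    then have "{t \<in> space (lebesgue_on {0..pi}). \<bar>f t - z\<bar> < e} \<in> sets (lebesgue_on {0..pi})" by measurable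
    then have "S \<in> sets (lebesgue_on {0..pi})" by (simp add: S_def)
    then show ?thesis by (auto simp: sets_restrict_space)
  qed
  ultimately have S: "negligible S" by (auto simp: negligible_iff_null_sets null_sets_def)
  have "negligible (uminus ` S)" by (intro negligible_differentiable_image_negligible S)
      (auto intro!: derivative_intros simp: differentiable_on_def)
  then have "negligible (S \<union> uminus ` S)" using S by simp
  moreover have "{t \<in> {-pi..pi}. cmod (complex_of_real (f t) - complex_of_real z) < e} \<subseteq> S \<union> uminus ` S"
  proof
    fix t assume "t \<in> {t \<in> {-pi..pi}. cmod (complex_of_real (f t) - complex_of_real z) < e}"
    then have t: "t \<in> {-pi..pi}" "\<bar>f t - z\<bar> < e"
      by (auto simp flip: of_real_diff)
    show "t \<in> S \<union> uminus ` S"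
    proof (cases "t \<ge> 0")
      case False
      then have "- t \<in> S" using t even by (auto simp: S_def)
      then show ?thesis by (metis UnI2 imageI minus_minus)
    qed (use t in \<open>auto simp: S_def\<close>)
  qed
  ultimately have "negligible {t \<in> {-pi..pi}. cmod (complex_of_real (f t) - complex_of_real z) < e}"
    by (rule negligible_subset)
  then have "emeasure lebesgue {t \<in> {-pi..pi}. cmod (complex_of_real (f t) - complex_of_real z) < e} = 0"
    by (simp add: negligible_iff_null_sets null_sets_def)
  moreover have "emeasure lebesgue {t \<in> {-pi..pi}. cmod (complex_of_real (f t) - complex_of_real z) < e} > 0"
    using ess e unfolding essential_range_def by blast
  ultimately show False by (simp only: less_irrefl)
qed

text \<open>Indices with \<open>y q < y i\<close> have \<open>l q \<le> l i \<le> t\<close> and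
  right summand 1; the others have \<open>y q \<ge> t + 2 * h\<close> and left summand 0. A large
  gap at a single index thus reverses the inequality between the sums that the limits
  enforce.\<close>

lemma ramp_sum_comparison:
  fixes y l :: "nat \<Rightarrow> real"
  assumes ord: "\<And>p q. p \<in> I \<Longrightarrow> q \<in> I \<Longrightarrow> y p < y q \<Longrightarrow> l p \<le> l q"
    and h: "h > 0" and i: "i \<in> I" "l i \<le> t" "t + 2 * h \<le> y i"
  shows "(\<Sum>q\<in>I. ramp h (t + h) (y q)) \<le> (\<Sum>q\<in>I. ramp h t (l q))"
proof (rule sum_mono)
  fix q assume q: "q \<in> I"
  show "ramp h (t + h) (y q) \<le> ramp h t (l q)"
  proof (cases "y q < y i")
    case True
    then have "l q \<le> t" using ord[OF q i(1)] i(2) by simp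
    then show ?thesis using ramp_eq_1[OF h] ramp_bounds by simp
  next
    case False
    then have "ramp h (t + h) (y q) = 0" using i(3) by (intro ramp_eq_0[OF h]) simp
    then show ?thesis using ramp_bounds by simp
  qed
qed

text \<open>As \<open>R\<close> increases strictly, for large \<open>n\<close> the sum of either
  family at a threshold \<open>t\<close> lies below that of the other at \<open>t + h\<close>; a gap
  above \<open>3 * h\<close> contradicts this at some threshold. Of the \<open>3 * h\<close>, up to
  \<open>h\<close> goes into reaching a threshold and \<open>2 * h\<close> into the
  comparison.\<close>

lemma similarly_ordered_uniformly_close:
  fixes y l :: "nat \<Rightarrow> nat \<Rightarrow> real" and I :: "nat \<Rightarrow> nat set" and c :: "nat \<Rightarrow> real"
  assumes ord: "\<And>n p q. n \<ge> 1 \<Longrightarrow> p \<in> I n \<Longrightarrow> q \<in> I n \<Longrightarrow> y n p < y n q \<Longrightarrow> l n p \<le> l n q"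
    and bds: "\<And>n i. n \<ge> 1 \<Longrightarrow> i \<in> I n \<Longrightarrow> y n i \<in> {\<alpha>..\<beta>} \<and> l n i \<in> {\<alpha>..\<beta>}"
    and c: "\<And>n. c n > 0" and h: "h > 0"
    and limy: "\<And>t. (\<lambda>n. (\<Sum>i\<in>I n. ramp h t (y n i)) * c n) \<longlonglongrightarrow> R t"
    and liml: "\<And>t. (\<lambda>n. (\<Sum>i\<in>I n. ramp h t (l n i)) * c n) \<longlonglongrightarrow> R t"
    and gap: "\<And>z. z \<in> {\<alpha>..\<beta>} \<Longrightarrow> R (z - h) < R z"
  shows "eventually (\<lambda>n. \<forall>i\<in>I n. \<bar>y n i - l n i\<bar> \<le> 3 * h) sequentially"
proof -
  \<comment> \<open>Finitely many thresholds, so that one bound on \<open>n\<close> serves them all;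
    the condition keeps \<open>\<alpha> + real j * h + h\<close> inside
    \<open>{\<alpha>..\<beta>}\<close>, where \<open>gap\<close> applies.\<close>
  define J where "J = {j \<in> {..nat \<lceil>(\<beta> - \<alpha>) / h\<rceil>}. \<alpha> + real j * h + h \<le> \<beta>}"
  define A where "A w n t = (\<Sum>i\<in>I n. ramp h t (w n i))" for w :: "nat \<Rightarrow> nat \<Rightarrow> real" and n t
  have sep: "eventually (\<lambda>n. \<forall>j\<in>J. A w n (\<alpha> + real j * h) < A w' n (\<alpha> + real j * h + h)) sequentially"
    if w: "\<And>t. (\<lambda>n. A w n t * c n) \<longlonglongrightarrow> R t" and w': "\<And>t. (\<lambda>n. A w' n t * c n) \<longlonglongrightarrow> R t" for w w'
  proof (rule eventually_ball_finite)
    show "finite J" by (simp add: J_def)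
    show "\<forall>j\<in>J. eventually (\<lambda>n. A w n (\<alpha> + real j * h) < A w' n (\<alpha> + real j * h + h)) sequentially"
    proof
      fix j assume "j \<in> J"
      then have "R (\<alpha> + real j * h) < R (\<alpha> + real j * h + h)"
        using gap[of "\<alpha> + real j * h + h"] h by (auto simp: J_def)
      from order_tendstoD(1)[OF tendsto_diff[OF w' w], of 0 "\<alpha> + real j * h + h" "\<alpha> + real j * h"] this
      have "eventually (\<lambda>n. 0 < A w' n (\<alpha> + real j * h + h) * c n - A w n (\<alpha> + real j * h) * c n) sequentially"
        by simp
      then show "eventually (\<lambda>n. A w n (\<alpha> + real j * h) < A w' n (\<alpha> + real j * h + h)) sequentially"
        by eventually_elim (simp add: c)
    qed
  qed
  have pick: "\<exists>j\<in>J. a \<le> \<alpha> + real j * h \<and> \<alpha> + real j * h + 2 * h \<le> b"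
    if ab: "a \<in> {\<alpha>..\<beta>}" "b \<in> {\<alpha>..\<beta>}" "a + 3 * h < b" for a b
  proof -
    \<comment> \<open>The first threshold at or above \<open>a\<close>, less than \<open>h\<close>
      away from it.\<close>
    define j where "j = nat \<lceil>(a - \<alpha>) / h\<rceil>"
    have "0 \<le> (a - \<alpha>) / h" using ab h by simp
    then have j: "real j = of_int \<lceil>(a - \<alpha>) / h\<rceil>" by (simp add: j_def)
    have "(a - \<alpha>) / h \<le> real j" "real j < (a - \<alpha>) / h + 1" unfolding j by linarith+
    then have *: "a \<le> \<alpha> + real j * h" "\<alpha> + real j * h < a + h" using h by (simp_all add: field_simps)
    have "j \<le> nat \<lceil>(\<beta> - \<alpha>) / h\<rceil>"
      unfolding j_def using ab h by (intro nat_mono ceiling_mono divide_right_mono) auto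
    then have "j \<in> J" using * ab h by (auto simp: J_def)
    then show ?thesis using * ab(3) by (intro bexI[of _ j]) auto
  qed
  have "eventually (\<lambda>n. \<forall>j\<in>J. A l n (\<alpha> + real j * h) < A y n (\<alpha> + real j * h + h)) sequentially"
    using limy liml by (intro sep) (simp_all add: A_def)
  moreover have "eventually (\<lambda>n. \<forall>j\<in>J. A y n (\<alpha> + real j * h) < A l n (\<alpha> + real j * h + h)) sequentially"
    using limy liml by (intro sep) (simp_all add: A_def)
  moreover note eventually_ge_at_top[of 1]
  ultimately show ?thesis
  proof eventually_elim
    case (elim n)
    show ?case
    proof
      fix i assume i: "i \<in> I n"
      \<comment> \<open>The contrapositive of \<open>ord\<close>; it makes the situation symmetric
        in \<open>y\<close> and \<open>l\<close>.\<close>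
      have ord': "y n p \<le> y n q" if "p \<in> I n" "q \<in> I n" "l n p < l n q" for p q
        using ord[OF elim(3) that(2,1)] that(3) by linarith
      have "\<not> l n i + 3 * h < y n i"
      proof
        assume "l n i + 3 * h < y n i"
        then obtain j where j: "j \<in> J" "l n i \<le> \<alpha> + real j * h" "\<alpha> + real j * h + 2 * h \<le> y n i"
          using pick bds[OF elim(3) i] by blast
        then show False
          using ramp_sum_comparison[of "I n" "y n" "l n", OF ord[OF elim(3)] h i j(2,3)] elim(1)
          by (fastforce simp: A_def)
      qed
      moreover have "\<not> y n i + 3 * h < l n i"
      proof
        assume "y n i + 3 * h < l n i"
        then obtain j where j: "j \<in> J" "y n i \<le> \<alpha> + real j * h" "\<alpha> + real j * h + 2 * h \<le> l n i"
          using pick bds[OF elim(3) i] by blast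
        then show False
          using ramp_sum_comparison[of "I n" "l n" "y n", OF ord' h i j(2,3)] elim(2)
          by (fastforce simp: A_def)
      qed
      ultimately show "\<bar>y n i - l n i\<bar> \<le> 3 * h" by linarith
    qed
  qed
qed

section \<open>Eigenbases ordered like the samples, and the conclusion\<close>

lemma injective_refinement:
  fixes y :: "nat \<Rightarrow> real"
  obtains d :: "nat \<Rightarrow> real" where "inj_on d {1..n}"
    "\<And>p q. p \<in> {1..n} \<Longrightarrow> q \<in> {1..n} \<Longrightarrow> y p < y q \<Longrightarrow> d p < d q"
proof
  define r where "r i = card {j \<in> {1..n}. y j < y i}" for i
  \<comment> \<open>Samples may coincide, but weights must not: the rank is the leading digit in
    base \<open>n + 1\<close>, and the index, which is at most \<open>n\<close>, breaks
    ties.\<close>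
  define d where "d i = real (r i * (n + 1) + i)" for i
  show "inj_on d {1..n}"
  proof (rule inj_onI)
    fix i j assume "i \<in> {1..n}" "j \<in> {1..n}" "d i = d j"
    then have "(r i * (n + 1) + i) mod (n + 1) = (r j * (n + 1) + j) mod (n + 1)" "i < n + 1" "j < n + 1"
      unfolding d_def of_nat_eq_iff by auto
    then show "i = j" by (simp only: mod_mult_self3 mod_less)
  qed
  fix p q assume pq: "p \<in> {1..n}" "q \<in> {1..n}" "y p < y q"
  then have "r p < r q" unfolding r_def by (intro psubset_card_mono) auto
  then have "(r p + 1) * (n + 1) \<le> r q * (n + 1)" by (intro mult_right_mono) auto
  then have "r p * (n + 1) + p < r q * (n + 1) + q" using pq by simp
  then show "d p < d q" unfolding d_def of_nat_less_iff .
qed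

lemma ordered_toeplitz_eigenbasis:
  fixes y :: "nat \<Rightarrow> real"
  obtains u :: "nat \<Rightarrow> nat \<Rightarrow> real" and l :: "nat \<Rightarrow> real" where
    "orthonormal n u" "alternating n u"
    "\<And>i j. i \<in> {1..n} \<Longrightarrow> j \<in> {1..n} \<Longrightarrow> mult_vec n (toeplitz_fun f) (u i) j = l i * u i j"
    "\<And>p q. p \<in> {1..n} \<Longrightarrow> q \<in> {1..n} \<Longrightarrow> even p = even q \<Longrightarrow> y p < y q \<Longrightarrow> l p \<le> l q"
proof -
  obtain d :: "nat \<Rightarrow> real" where d: "inj_on d {1..n}"
    "\<And>p q. p \<in> {1..n} \<Longrightarrow> q \<in> {1..n} \<Longrightarrow> y p < y q \<Longrightarrow> d p < d q"
    using injective_refinement by blast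
  show thesis
  \<comment> \<open>The sine basis witnesses that alternating orthonormal bases exist.\<close>
  proof (rule alternating_eigenbasis[OF symmetric_toeplitz_fun[of n f] centrosymmetric_toeplitz_fun
        orthonormal_sine_basis alternating_sine_basis d(1)])
    fix u l
    assume "orthonormal n u" "alternating n u"
      "\<And>i j. i \<in> {1..n} \<Longrightarrow> j \<in> {1..n} \<Longrightarrow> mult_vec n (toeplitz_fun f) (u i) j = l i * u i j"
      and "\<And>p q. p \<in> {1..n} \<Longrightarrow> q \<in> {1..n} \<Longrightarrow> even p = even q \<Longrightarrow> d p < d q \<Longrightarrow> l p \<le> l q"
    then show thesis using d(2) by (intro that) auto
  qed
qed

text \<open>An eigenvalue is the value of the quadratic form at its unit eigenvector.\<close>

lemma toeplitz_eigenvalue_bounds: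
  assumes f: "bounded_measurable f" and bd: "\<And>t. t \<in> {0..pi} \<Longrightarrow> \<alpha> \<le> f t \<and> f t \<le> \<beta>"
    and u: "orthonormal n u" and i: "i \<in> {1..n}"
    and eig: "\<And>j. j \<in> {1..n} \<Longrightarrow> mult_vec n (toeplitz_fun f) (u i) j = l * u i j"
  shows "l \<in> {\<alpha>..\<beta>}"
proof -
  have one: "dotp n (u i) (u i) = 1" using u i by (simp add: orthonormal_def)
  have "dotp n (u i) (mult_vec n (toeplitz_fun f) (u i)) = dotp n (u i) (\<lambda>j. l * u i j + 0 * u i j)"
    using eig by (intro dotp_cong) auto
  also have "\<dots> = l" unfolding dotp_lincomb_right one by simp
  finally show ?thesis
    using toeplitz_quadratic_form_bounds[OF f bd, of n "u i"] one by simp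
qed

theorem theorem3p2:
  fixes f :: "real \<Rightarrow> real" and x :: "nat \<Rightarrow> nat \<Rightarrow> real"
  assumes even: "\<forall>t\<in>{-pi..pi}. f (- t) = f t"
    and bounded: "bounded (f ` {-pi..pi})"
    and cont_ae: "AE t in lebesgue. t \<in> {-pi..pi} \<longrightarrow> continuous (at t within {-pi..pi}) f"
    and ess_range: "essential_range {-pi..pi} (\<lambda>t. complex_of_real (f t)) =
      complex_of_real ` {(INF t\<in>{0..pi}. f t)..(SUP t\<in>{0..pi}. f t)}"
    and grid: "asymptotically_uniform 0 pi (\<lambda>n. n) x"
  shows "\<exists>(V :: nat \<Rightarrow> complex mat) (lT :: nat \<Rightarrow> nat \<Rightarrow> complex) (lH :: nat \<Rightarrow> nat \<Rightarrow> complex).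
    (\<forall>n\<ge>1.
       real_unitary_mat n (V n) \<and>
       eigenvalue_ordering n (toeplitz_mat n (\<lambda>t. complex_of_real (f t))) (lT n) \<and>
       eigenvalue_ordering n (flipped_toeplitz_mat n (\<lambda>t. complex_of_real (f t))) (lH n) \<and>
       exchange_mat n = V n * diag1 n (\<lambda>i. (-1) ^ (i + 1)) * mat_adjoint (V n) \<and>
       toeplitz_mat n (\<lambda>t. complex_of_real (f t)) =
         V n * diag1 n (lT n) * mat_adjoint (V n) \<and>
       flipped_toeplitz_mat n (\<lambda>t. complex_of_real (f t)) =
         V n * diag1 n (lH n) * mat_adjoint (V n) \<and>
       diag1 n (lH n) = diag1 n (\<lambda>i. (-1) ^ (i + 1)) * diag1 n (lT n) \<and>
       (\<forall>i\<in>{1..n}. lH n i = (-1) ^ (i + 1) * lT n i)) \<and>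
    (\<lambda>n. MAX i\<in>{1..n}. cmod (complex_of_real (f (x n i)) - lT n i)) \<longlonglongrightarrow> 0"
proof -
  define \<alpha> where "\<alpha> = (INF t\<in>{0..pi}. f t)"
  define \<beta> where "\<beta> = (SUP t\<in>{0..pi}. f t)"
  let ?F = "\<lambda>t. complex_of_real (f t)"
  have "f ` {0..pi} \<subseteq> f ` {-pi..pi}" by (intro image_mono) auto
  then have bd0: "bounded (f ` {0..pi})" using bounded bounded_subset by blast
  have cont: "AE t in lebesgue_on {0..pi}. continuous (at t within {0..pi}) f"
  proof -
    have "AE t in lebesgue. t \<in> {0..pi} \<longrightarrow> continuous (at t within {0..pi}) f"
      using cont_ae
    proof eventually_elim
      case (elim t)
      then show ?case by (auto intro: continuous_within_subset[of _ "{-pi..pi}"])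
    qed
    then show ?thesis by (simp add: AE_restrict_space_iff)
  qed
  have f: "bounded_measurable f" by (rule AE_continuous_imp_bounded_measurable[OF cont bd0])
  have bds: "\<alpha> \<le> f t \<and> f t \<le> \<beta>" if "t \<in> {0..pi}" for t
    using bd0 that bounded_imp_bdd_below bounded_imp_bdd_above
    unfolding \<alpha>_def \<beta>_def by (auto intro: cINF_lower cSUP_upper)
  have xin: "x n i \<in> {0..pi}" if "i \<in> {1..n}" for n i
    using grid that by (simp add: asymptotically_uniform_def)
  define P where "P n u l \<longleftrightarrow> orthonormal n u \<and> alternating n u \<and>
    (\<forall>i\<in>{1..n}. \<forall>j\<in>{1..n}. mult_vec n (toeplitz_fun f) (u i) j = l i * u i j) \<and>
    (\<forall>p\<in>{1..n}. \<forall>q\<in>{1..n}. even p = even q \<longrightarrow> f (x n p) < f (x n q) \<longrightarrow> l p \<le> l q)"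
    for n and u :: "nat \<Rightarrow> nat \<Rightarrow> real" and l :: "nat \<Rightarrow> real"
  have "\<exists>u l. P n u l" for n
    using ordered_toeplitz_eigenbasis[of n f "\<lambda>i. f (x n i)"] unfolding P_def by metis
  then obtain u l where P: "\<And>n. P n (u n) (l n)" by metis
  have u: "orthonormal n (u n)" "alternating n (u n)" for n
    using P[of n] by (simp_all add: P_def)
  have eig: "mult_vec n (toeplitz_fun f) (u n i) j = l n i * u n i j"
    if "i \<in> {1..n}" "j \<in> {1..n}" for n i j
    using P[of n] that unfolding P_def by blast
  have ord: "l n p \<le> l n q"
    if "p \<in> {1..n}" "q \<in> {1..n}" "even p = even q" "f (x n p) < f (x n q)" for n p q
    using P[of n] that unfolding P_def by blast
  have lbds: "l n i \<in> {\<alpha>..\<beta>}" if "i \<in> {1..n}" for n i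
    by (rule toeplitz_eigenvalue_bounds[OF f bds u(1) that eig[OF that]])
  \<comment> \<open>Within a class, samples and eigenvalues have the same limits of ramp averages,
    and the essential range makes these limits strictly increasing in the threshold.\<close>
  have close: "eventually (\<lambda>n. \<forall>i\<in>parity_class n e. \<bar>f (x n i) - l n i\<bar> \<le> 3 * h) sequentially"
    if h: "h > 0" for h e
  proof (rule similarly_ordered_uniformly_close[where \<alpha> = \<alpha> and \<beta> = \<beta> and c = "\<lambda>n. 2 * pi / real (n + 1)"
        and R = "\<lambda>t. LINT s|lebesgue_on {0..pi}. ramp h t (f s)"])
    have h': "1 / h \<ge> 0" using h by simp
    show "(\<lambda>n. (\<Sum>i\<in>parity_class n e. ramp h t (f (x n i))) * (2 * pi / real (n + 1)))
      \<longlonglongrightarrow> (LINT s|lebesgue_on {0..pi}. ramp h t (f s))" for t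
      by (rule parity_Riemann_sum[OF bounded_measurable_Lipschitz_comp[OF f ramp_Lipschitz[OF h] h']
            Lipschitz_comp_continuous[OF ramp_Lipschitz[OF h] h' cont] grid])
    show "(\<lambda>n. (\<Sum>i\<in>parity_class n e. ramp h t (l n i)) * (2 * pi / real (n + 1)))
      \<longlonglongrightarrow> (LINT s|lebesgue_on {0..pi}. ramp h t (f s))" for t
      by (rule eigenvalue_distribution[OF f cont u eig ramp_Lipschitz[OF h] h'])
    show "(LINT s|lebesgue_on {0..pi}. ramp h (z - h) (f s)) < (LINT s|lebesgue_on {0..pi}. ramp h z (f s))"
      if "z \<in> {\<alpha>..\<beta>}" for z
      using that h ess_range unfolding \<alpha>_def \<beta>_def
      by (intro integral_ramp_strict_mono f h emeasure_half_pos even) auto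
    show "f (x n i) \<in> {\<alpha>..\<beta>} \<and> l n i \<in> {\<alpha>..\<beta>}" if "i \<in> parity_class n e" for n i
      using that bds xin lbds by (auto simp: parity_class_def)
    show "l n p \<le> l n q" if "p \<in> parity_class n e" "q \<in> parity_class n e" "f (x n p) < f (x n q)" for n p q
      using that ord by (auto simp: parity_class_def)
  qed (use h in auto)
  define V where "V n = basis_mat n (u n)" for n
  define lT where "lT n i = complex_of_real (l n i)" for n i
  define lH where "lH n i = (-1) ^ (i + 1) * lT n i" for n i
  have "(\<lambda>n. MAX i\<in>{1..n}. cmod (complex_of_real (f (x n i)) - lT n i)) \<longlonglongrightarrow> 0"
  proof (rule LIMSEQ_I)
    fix r :: real assume r: "r > 0"
    define h where "h = r / 4"
    have h: "h > 0" "3 * h < r" using r by (simp_all add: h_def)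
    have "eventually (\<lambda>n. norm ((MAX i\<in>{1..n}. cmod (complex_of_real (f (x n i)) - lT n i)) - 0) < r) sequentially"
      \<comment> \<open>The two classes exhaust the indices, and \<open>n \<ge> 1\<close> makes the
        maximum one over a nonempty set.\<close>
      using close[OF h(1), of True] close[OF h(1), of False] eventually_ge_at_top[of 1]
    proof eventually_elim
      case (elim n)
      let ?S = "(\<lambda>i. cmod (complex_of_real (f (x n i)) - lT n i)) ` {1..n}"
      have S: "finite ?S" "?S \<noteq> {}" using elim(3) by auto
      have "v < r \<and> 0 \<le> v" if v: "v \<in> ?S" for v
      proof -
        obtain i where i: "i \<in> {1..n}" "v = cmod (complex_of_real (f (x n i)) - lT n i)" using v by blast
        have "\<bar>f (x n i) - l n i\<bar> \<le> 3 * h"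
          using elim(1,2) i(1) by (cases "even i") (auto simp: parity_class_def)
        moreover have "v = \<bar>f (x n i) - l n i\<bar>"
          unfolding i(2) lT_def of_real_diff[symmetric] norm_of_real ..
        ultimately show ?thesis using h(2) by simp
      qed
      then have "Max ?S < r \<and> 0 \<le> Max ?S" using Max_in[OF S] by blast
      then show ?case by simp
    qed
    then show "\<exists>N. \<forall>n\<ge>N. norm ((MAX i\<in>{1..n}. cmod (complex_of_real (f (x n i)) - lT n i)) - 0) < r"
      by (simp add: eventually_sequentially)
  qed
  moreover have "real_unitary_mat n (V n) \<and>
       eigenvalue_ordering n (toeplitz_mat n ?F) (lT n) \<and>
       eigenvalue_ordering n (flipped_toeplitz_mat n ?F) (lH n) \<and>
       exchange_mat n = V n * diag1 n (\<lambda>i. (-1) ^ (i + 1)) * mat_adjoint (V n) \<and>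
       toeplitz_mat n ?F = V n * diag1 n (lT n) * mat_adjoint (V n) \<and>
       flipped_toeplitz_mat n ?F = V n * diag1 n (lH n) * mat_adjoint (V n) \<and>
       diag1 n (lH n) = diag1 n (\<lambda>i. (-1) ^ (i + 1)) * diag1 n (lT n) \<and>
       (\<forall>i\<in>{1..n}. lH n i = (-1) ^ (i + 1) * lT n i)" for n
  proof -
    have V: "real_unitary_mat n (V n)" unfolding V_def by (rule real_unitary_basis_mat[OF u(1)])
    have car: "toeplitz_mat n ?F \<in> carrier_mat n n" "exchange_mat n \<in> carrier_mat n n"
      by (simp_all add: toeplitz_mat_def exchange_mat_def)
    then have carH: "flipped_toeplitz_mat n ?F \<in> carrier_mat n n" by (simp add: flipped_toeplitz_mat_def)
    have T: "toeplitz_mat n ?F * V n = V n * diag1 n (lT n)"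
      unfolding V_def lT_def by (rule toeplitz_mat_mult_basis[OF fourier_coeff_even[OF f even] eig])
    have H: "flipped_toeplitz_mat n ?F * V n = V n * diag1 n (lH n)"
      unfolding lH_def using flipped_toeplitz_mat_mult_basis[OF T[unfolded V_def] u(2)] by (simp only: V_def)
    have Y: "exchange_mat n * V n = V n * diag1 n (\<lambda>i. (-1) ^ (i + 1))"
      unfolding V_def by (rule exchange_mat_mult_basis[OF u(2)])
    have D: "diag1 n (lH n) = diag1 n (\<lambda>i. (-1) ^ (i + 1)) * diag1 n (lT n)"
      unfolding diag1_mult lH_def ..
    show ?thesis
      using V real_unitary_diagonalization[OF V car(1) T] real_unitary_diagonalization[OF V carH H]
        real_unitary_diagonalization(1)[OF V car(2) Y] D
      by (intro conjI ballI) (assumption | simp only: lH_def)+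
  qed
  ultimately show ?thesis by blast
qed

end
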